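(* Let $N$ be a positive integer that is a multiple of $4$, and let $H_N$ be the Hadamard graph on $2^N$ vertices. Then $$\chi_q(H_N) = N,$$ where $\chi_q$ denotes the quantum chromatic number.
   Context: Hadamard graph: for $N$ a positive multiple of $4$, $H_N$ is the simple graph whose vertices are the $2^N$ vectors in $\{+1,-1\}^N$, two vertices being adjacent if and only if their inner product is $0$ (equivalently, they differ in exactly half of their entries). Quantum chromatic number: for a finite simple graph $G$ and a positive integer $c$, a winning quantum strategy with $c$ colors in the graph coloring game for $G$ consists of positive integers $a,b$, a unit vector $\psi\in\mathbb{C}^a\otimes\mathbb{C}^b$, and, for each vertex $x\in V(G)$, positive operator valued measures $\{E_{x,\alpha}\}_{\alpha=1}^c\subset M_a(\mathbb{C})$ and $\{F_{x,\alpha}\}_{\alpha=1}^c\subset M_b(\mathbb{C})$ (positive semidefinite matrices with $\sum_\alpha E_{x,\alpha}=I$ and $\sum_\alpha F_{x,\alpha}=I$), such that the probabilities $p(\alpha,\beta\mid x,y)=\langle\psi|E_{x,\alpha}\otimes F_{y,\beta}|\psi\rangle$ satisfy: (1) $p(\alpha,\beta\mid x,x)=0$ for every vertex $x$ and all $\alpha\neq\beta$; (2) $p(\alpha,\alpha\mid x,y)=0$ for all adjacent vertices $x\sim y$ and every color $\alpha$. The quantum chromatic number $\chi_q(G)$ is the smallest $c$ for which a winning quantum strategy with $c$ colors exists. *)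

theory Defs
  imports
    "Graph_Theory.Pair_Digraph"
    "Jordan_Normal_Form.Schur_Decomposition"
begin

text \<open>A finite simple graph is a \<^locale>\<open>pair_graph\<close>: an edge between \<open>x\<close> and \<open>y\<close> is the pair of
  arcs \<open>(x, y)\<close> and \<open>(y, x)\<close>.\<close>

definition sign_vectors :: "nat \<Rightarrow> int vec set" where
  "sign_vectors N = {x \<in> carrier_vec N. \<forall>i<N. x $ i = 1 \<or> x $ i = - 1}"

definition hadamard_graph :: "nat \<Rightarrow> int vec pair_pre_digraph" where
  "hadamard_graph N =
    \<lparr> pverts = sign_vectors N,
      parcs = {(x, y). x \<in> sign_vectors N \<and> y \<in> sign_vectors N \<and> x \<bullet> y = 0} \<rparr>"

text \<open>The order on \<^typ>\<open>complex\<close> compares real parts of numbers with equal imaginary part, so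
  \<open>0 \<le> z\<close> says that \<open>z\<close> is real and nonnegative; \<open>v \<bullet>c w\<close> is conjugate-linear in \<open>w\<close>.\<close>

definition pos_semidef :: "nat \<Rightarrow> complex mat \<Rightarrow> bool" where
  "pos_semidef n A \<longleftrightarrow>
    A \<in> carrier_mat n n \<and> mat_adjoint A = A \<and> (\<forall>v \<in> carrier_vec n. 0 \<le> (A *\<^sub>v v) \<bullet>c v)"

definition povm :: "nat \<Rightarrow> nat \<Rightarrow> (nat \<Rightarrow> complex mat) \<Rightarrow> bool" where
  "povm n c E \<longleftrightarrow>
    (\<forall>\<alpha> \<in> {1..c}. pos_semidef n (E \<alpha>)) \<and>
    mat n n (\<lambda>ij. \<Sum>\<alpha> = 1..c. E \<alpha> $$ ij) = 1\<^sub>m n"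

text \<open>Kronecker product: \<open>\<complex>\<^sup>a \<otimes> \<complex>\<^sup>b\<close> is identified with \<open>\<complex>\<^bsup>ab\<^esup>\<close> by sending \<open>e\<^sub>i \<otimes> e\<^sub>j\<close> to
  \<open>e\<^bsub>ib+j\<^esub>\<close>, indices starting at 0.\<close>

definition kronecker :: "complex mat \<Rightarrow> complex mat \<Rightarrow> complex mat" where
  "kronecker A B =
    mat (dim_row A * dim_row B) (dim_col A * dim_col B)
      (\<lambda>(i, j). A $$ (i div dim_row B, j div dim_col B) * B $$ (i mod dim_row B, j mod dim_col B))"

definition outcome_prob :: "complex vec \<Rightarrow> complex mat \<Rightarrow> complex mat \<Rightarrow> complex" where
  "outcome_prob \<psi> A B = (kronecker A B *\<^sub>v \<psi>) \<bullet>c \<psi>"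

definition winning_quantum_strategy ::
  "'v pair_pre_digraph \<Rightarrow> nat \<Rightarrow> nat \<Rightarrow> nat \<Rightarrow> complex vec \<Rightarrow>
    ('v \<Rightarrow> nat \<Rightarrow> complex mat) \<Rightarrow> ('v \<Rightarrow> nat \<Rightarrow> complex mat) \<Rightarrow> bool" where
  "winning_quantum_strategy G c a b \<psi> E F \<longleftrightarrow>
    0 < a \<and> 0 < b \<and>
    \<psi> \<in> carrier_vec (a * b) \<and> \<psi> \<bullet>c \<psi> = 1 \<and>
    (\<forall>x \<in> pverts G. povm a c (E x) \<and> povm b c (F x)) \<and>
    (\<forall>x \<in> pverts G. \<forall>\<alpha> \<in> {1..c}. \<forall>\<beta> \<in> {1..c}.
      \<alpha> \<noteq> \<beta> \<longrightarrow> outcome_prob \<psi> (E x \<alpha>) (F x \<beta>) = 0) \<and>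
    (\<forall>x y. (x, y) \<in> parcs G \<longrightarrow>
      (\<forall>\<alpha> \<in> {1..c}. outcome_prob \<psi> (E x \<alpha>) (F y \<alpha>) = 0))"

definition quantum_chromatic_number :: "'v pair_pre_digraph \<Rightarrow> nat" where
  "quantum_chromatic_number G =
    (LEAST c. 0 < c \<and> (\<exists>a b \<psi> E F. winning_quantum_strategy G c a b \<psi> E F))"

lemma card_sign_vectors: "finite (sign_vectors N) \<and> card (sign_vectors N) = 2 ^ N"
proof -
  let ?L = "{xs. set xs \<subseteq> {1, - 1 :: int} \<and> length xs = N}"
  have eq: "sign_vectors N = vec_of_list ` ?L"
  proof (intro equalityI subsetI)
    fix x assume x: "x \<in> sign_vectors N"
    then have "list_of_vec x \<in> ?L"
      by (auto simp: sign_vectors_def set_list_of_vec vec_set_def)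
    moreover have "x = vec_of_list (list_of_vec x)" by (simp add: vec_list)
    ultimately show "x \<in> vec_of_list ` ?L" by blast
  next
    fix x assume "x \<in> vec_of_list ` ?L"
    then obtain xs where xs: "x = vec_of_list xs" "set xs \<subseteq> {1, - 1}" "length xs = N" by blast
    have "xs ! i = 1 \<or> xs ! i = - 1" if "i < N" for i
    proof -
      have "xs ! i \<in> {1, - 1}" using xs that nth_mem[of i xs] by (meson subsetD)
      then show ?thesis by blast
    qed
    moreover have "x $ i = xs ! i" for i unfolding xs(1) by (rule vec_of_list_index)
    moreover have "x \<in> carrier_vec N"
      unfolding xs(1) by (rule carrier_vecI) (metis dim_vec_of_list xs(3))
    ultimately show "x \<in> sign_vectors N" unfolding sign_vectors_def by simp
  qed
  have inj: "inj_on vec_of_list ?L" by (rule inj_on_inverseI[of _ list_of_vec]) (simp add: list_vec)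
  have fin: "finite {1, - 1 :: int}" by simp
  have "finite ?L" using fin by (rule finite_lists_length_eq)
  moreover have "card ?L = 2 ^ N" using card_lists_length_eq[OF fin, of N] by (simp add: numeral_2_eq_2)
  ultimately show ?thesis unfolding eq using inj by (auto simp: card_image)
qed

lemma pair_graph_hadamard_graph:
  assumes "0 < N"
  shows "pair_graph (hadamard_graph N)"
proof -
  have fin: "finite (sign_vectors N)" using card_sign_vectors by blast
  have nz: "x \<bullet> x \<noteq> 0" if x: "x \<in> sign_vectors N" for x
  proof -
    have "x $ i * x $ i = 1" if "i < N" for i
      using x that by (auto simp: sign_vectors_def)
    moreover have "dim_vec x = N" using x by (simp add: sign_vectors_def)
    ultimately have "x \<bullet> x = int N" by (simp add: scalar_prod_def)
    then show ?thesis using assms by simp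
  qed
  have comm: "x \<bullet> y = y \<bullet> x" if "x \<in> sign_vectors N" "y \<in> sign_vectors N" for x y :: "int vec"
    using that by (intro comm_scalar_prod) (auto simp: sign_vectors_def)
  have "parcs (hadamard_graph N) \<subseteq> sign_vectors N \<times> sign_vectors N"
    by (auto simp: hadamard_graph_def)
  then have finA: "finite (parcs (hadamard_graph N))"
    using fin by (meson finite_SigmaI finite_subset)
  show ?thesis
  proof
    show "finite (parcs (hadamard_graph N))" by (rule finA)
    show "symmetric (with_proj (hadamard_graph N))"
      unfolding symmetric_def sym_def hadamard_graph_def with_proj_simps
      by simp (metis comm)
  qed (use fin nz in \<open>auto simp: hadamard_graph_def\<close>)
qed

end

theory Submission
  imports Defs "HOL-Combinatorics.Transposition"
begin

text \<open>
  The upper bound comes from one explicit strategy, the lower bound from a quantum version of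
  Hoffman's eigenvalue bound.

  Strategy with \<open>N\<close> colours. The players share the maximally entangled state of
  \<open>\<complex>\<^sup>N \<otimes> \<complex>\<^sup>N\<close>. On input \<open>x\<close> the first one measures in the Fourier basis multiplied entrywise by
  \<open>x\<close>, the second one in the complex conjugate basis. The probability of a pair of answers is then
  the squared modulus of an inner product of two basis vectors, up to the factor \<open>1 / N\<close>. For equal
  inputs the two vectors belong to one orthonormal basis. For equal answers the Fourier
  phases cancel, which leaves \<open>x \<bullet> y / N\<close> (\<open>hadamard_graph_quantum_colouring\<close>).

  No fewer colours. Let \<open>P\<^sub>x\<^sub>\<alpha> = E\<^sub>x\<^sub>\<alpha> \<otimes> 1\<close> and \<open>Q\<^sub>x\<^sub>\<alpha> = 1 \<otimes> F\<^sub>x\<^sub>\<alpha>\<close>. Perfect agreement on equal inputs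
  forces \<open>P\<^sub>x\<^sub>\<alpha> \<psi> = Q\<^sub>x\<^sub>\<alpha> \<psi>\<close> (\<open>consistent_povms_agree\<close>). The common vectors \<open>v\<^sub>x\<^sub>\<alpha>\<close> therefore satisfy:
  for fixed \<open>x\<close> they are pairwise orthogonal with sum \<open>\<psi>\<close>, and for fixed \<open>\<alpha>\<close> the vectors at adjacent
  vertices are orthogonal. So for each colour the Gram matrix of \<open>(v\<^sub>x\<^sub>\<alpha>)\<^sub>x\<close> vanishes on the edges.

  The Hadamard graph is a Cayley graph of \<open>{1, -1}\<^sup>N\<close>, so the Walsh characters diagonalise
  its adjacency matrix \<open>A\<close>. The eigenvalue at \<open>S\<close> is the sum of \<open>\<Prod>i\<in>S. z\<^sub>i\<close> over the \<open>C\<close> balanced sign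
  vectors \<open>z\<close>; it is \<open>C\<close> at \<open>S = {}\<close> and at least \<open>- C / (N - 1)\<close> elsewhere (\<open>hadamard_eigenvalue_ge\<close>).
  Hence \<open>(N - 1) A + C I - (N C / 2\<^sup>N) J\<close>, where \<open>J\<close> is the all-ones matrix, is positive
  semidefinite. Pairing it with the Gram matrix of colour \<open>\<alpha>\<close> gives
  \<open>N \<parallel>\<Sum>\<^sub>x v\<^sub>x\<^sub>\<alpha>\<parallel>\<^sup>2 \<le> 2\<^sup>N s\<^sub>\<alpha>\<close> with \<open>s\<^sub>\<alpha> = \<Sum>\<^sub>x \<parallel>v\<^sub>x\<^sub>\<alpha>\<parallel>\<^sup>2\<close>. Since \<open>\<Sum>\<^sub>x v\<^sub>x\<^sub>\<alpha>\<close> has inner product \<open>s\<^sub>\<alpha>\<close> with the unit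
  vector \<open>\<psi>\<close>, its squared norm is at least \<open>s\<^sub>\<alpha>\<^sup>2\<close>, and so \<open>s\<^sub>\<alpha> \<le> 2\<^sup>N / N\<close>. The \<open>s\<^sub>\<alpha>\<close> add up to \<open>2\<^sup>N\<close>, so
  there are at least \<open>N\<close> colours.
\<close>

section \<open>POVMs and inner products\<close>

lemma cinner_sum:
  assumes "v \<in> carrier_vec n" "w \<in> carrier_vec n"
  shows "v \<bullet>c w = (\<Sum>k<n. v $ k * cnj (w $ k))"
  using assms by (auto simp: scalar_prod_def atLeast0LessThan)

lemma cinner_cnj:
  assumes "v \<in> carrier_vec n" "w \<in> carrier_vec n"
  shows "cnj (v \<bullet>c w) = w \<bullet>c v"
  using assms by (simp add: cinner_sum mult.commute)

lemma cinner_norm: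
  assumes "v \<in> carrier_vec n"
  shows "v \<bullet>c v = of_real (\<Sum>k<n. (cmod (v $ k))\<^sup>2)"
  using assms by (simp add: cinner_sum complex_norm_square del: of_real_power)

lemma cinner_minus_left:
  assumes "u \<in> carrier_vec n" "v \<in> carrier_vec n" "w \<in> carrier_vec n"
  shows "(u - v) \<bullet>c w = u \<bullet>c w - (v \<bullet>c w :: complex)"
  using assms by (simp add: cinner_sum[of _ n] left_diff_distrib right_diff_distrib sum_subtractf)

lemma cinner_minus_right:
  assumes "u \<in> carrier_vec n" "v \<in> carrier_vec n" "w \<in> carrier_vec n"
  shows "w \<bullet>c (u - v) = w \<bullet>c u - (w \<bullet>c v :: complex)"
  using assms by (simp add: cinner_sum[of _ n] left_diff_distrib right_diff_distrib sum_subtractf)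

lemma mult_mat_vec_sum:
  assumes "A \<in> carrier_mat n m" "v \<in> carrier_vec m" "i < n"
  shows "(A *\<^sub>v v) $ i = (\<Sum>j<m. A $$ (i, j) * v $ j)"
  using assms by (auto simp: scalar_prod_def atLeast0LessThan)

lemma mat_adjoint_index:
  fixes A :: "complex mat"
  assumes "A \<in> carrier_mat n m" "i < m" "j < n"
  shows "mat_adjoint A $$ (i, j) = cnj (A $$ (j, i))"
  using assms by (simp add: mat_adjoint_def mat_of_rows_def)

lemma mat_adjoint_carrier:
  "A \<in> carrier_mat n m \<Longrightarrow> mat_adjoint A \<in> carrier_mat m n"
  by (auto simp: mat_adjoint_def)

lemma cinner_hermitian:
  fixes A :: "complex mat"
  assumes A: "A \<in> carrier_mat n n" "mat_adjoint A = A"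
    and "v \<in> carrier_vec n" "w \<in> carrier_vec n"
  shows "(A *\<^sub>v v) \<bullet>c w = v \<bullet>c (A *\<^sub>v w)"
proof -
  have h: "cnj (A $$ (j, i)) = A $$ (i, j)" if "i < n" "j < n" for i j
    using mat_adjoint_index[OF A(1) that] A(2) by simp
  have "(A *\<^sub>v v) \<bullet>c w = (\<Sum>i<n. \<Sum>j<n. A $$ (i, j) * v $ j * cnj (w $ i))"
    using assms by (simp add: cinner_sum[of _ n] mult_mat_vec_sum[of _ n n] sum_distrib_right
        del: index_mult_mat_vec)
  also have "\<dots> = (\<Sum>j<n. \<Sum>i<n. A $$ (i, j) * v $ j * cnj (w $ i))"
    by (rule sum.swap)
  also have "\<dots> = v \<bullet>c (A *\<^sub>v w)"
    using assms by (simp add: cinner_sum[of _ n] mult_mat_vec_sum[of _ n n] sum_distrib_left h mult_ac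
        del: index_mult_mat_vec)
  finally show ?thesis .
qed

lemma povmD:
  assumes "povm n c P" "\<alpha> \<in> {1..c}"
  shows "P \<alpha> \<in> carrier_mat n n" "mat_adjoint (P \<alpha>) = P \<alpha>"
    and "\<And>v. v \<in> carrier_vec n \<Longrightarrow> 0 \<le> (P \<alpha> *\<^sub>v v) \<bullet>c v"
  using assms by (auto simp: povm_def pos_semidef_def)

lemma povm_resolution:
  assumes P: "povm n c P" and v: "v \<in> carrier_vec n" and i: "i < n"
  shows "(\<Sum>\<alpha>=1..c. (P \<alpha> *\<^sub>v v) $ i) = v $ i"
proof -
  have "mat n n (\<lambda>ij. \<Sum>\<alpha>=1..c. P \<alpha> $$ ij) $$ (i, j) = 1\<^sub>m n $$ (i, j)" for j
    using P by (simp add: povm_def)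
  then have e: "(\<Sum>\<alpha>=1..c. P \<alpha> $$ (i, j)) = (if i = j then 1 else 0)" if "j < n" for j
    using that i by (metis index_mat(1) index_one_mat(1))
  have "(\<Sum>\<alpha>=1..c. (P \<alpha> *\<^sub>v v) $ i) = (\<Sum>\<alpha>=1..c. \<Sum>j<n. P \<alpha> $$ (i, j) * v $ j)"
    by (intro sum.cong refl mult_mat_vec_sum) (use povmD(1)[OF P] v i in auto)
  also have "\<dots> = (\<Sum>j<n. (\<Sum>\<alpha>=1..c. P \<alpha> $$ (i, j)) * v $ j)"
    unfolding sum_distrib_right by (rule sum.swap)
  also have "\<dots> = (\<Sum>j<n. if i = j then v $ j else 0)"
    by (intro sum.cong refl) (simp add: e del: One_nat_def)
  finally show ?thesis using i by simp
qed

lemma povm_resolution_cinner: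
  assumes P: "povm n c P" and v: "v \<in> carrier_vec n" "w \<in> carrier_vec n"
  shows "(\<Sum>\<alpha>=1..c. (P \<alpha> *\<^sub>v v) \<bullet>c w) = v \<bullet>c w"
proof -
  have "(\<Sum>\<alpha>=1..c. (P \<alpha> *\<^sub>v v) \<bullet>c w) = (\<Sum>\<alpha>=1..c. \<Sum>k<n. (P \<alpha> *\<^sub>v v) $ k * cnj (w $ k))"
    using povmD(1)[OF P] v by (intro sum.cong refl cinner_sum mult_mat_vec_carrier) auto
  also have "\<dots> = (\<Sum>k<n. (\<Sum>\<alpha>=1..c. (P \<alpha> *\<^sub>v v) $ k) * cnj (w $ k))"
    unfolding sum_distrib_right by (rule sum.swap)
  also have "\<dots> = v \<bullet>c w"
    unfolding cinner_sum[OF v] by (intro sum.cong refl) (simp only: povm_resolution[OF P v(1)] lessThan_iff)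
  finally show ?thesis .
qed

text \<open>An operator \<open>A\<close> with \<open>0 \<le> A \<le> 1\<close> satisfies \<open>A\<^sup>2 \<le> A\<close>. Positivity of \<open>A\<close> at \<open>v - A v\<close> reads
  \<open>0 \<le> \<langle>A v, v\<rangle> - 2 \<parallel>A v\<parallel>\<^sup>2 + \<langle>A (A v), A v\<rangle>\<close>, and the last term is at most \<open>\<parallel>A v\<parallel>\<^sup>2\<close> because the
  other effects of the measurement are positive. This argument avoids the square root of \<open>A\<close>.\<close>

lemma povm_effect_contraction:
  assumes P: "povm n c P" "\<alpha> \<in> {1..c}" and v: "v \<in> carrier_vec n"
  shows "Re ((P \<alpha> *\<^sub>v v) \<bullet>c (P \<alpha> *\<^sub>v v)) \<le> Re ((P \<alpha> *\<^sub>v v) \<bullet>c v)"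
proof -
  note A = povmD[OF P]
  define u where "u = P \<alpha> *\<^sub>v v"
  have u: "u \<in> carrier_vec n" unfolding u_def using A v by simp
  have Au: "P \<alpha> *\<^sub>v u \<in> carrier_vec n" using A(1) u by simp
  have "Re ((P \<alpha> *\<^sub>v u) \<bullet>c u) \<le> (\<Sum>\<beta>=1..c. Re ((P \<beta> *\<^sub>v u) \<bullet>c u))"
    using P(2) povmD(3)[OF P(1) _ u]
    by (intro member_le_sum) (auto simp: less_eq_complex_def)
  also have "\<dots> = Re (u \<bullet>c u)"
    using povm_resolution_cinner[OF P(1) u u] by (metis Re_sum)
  finally have 1: "Re ((P \<alpha> *\<^sub>v u) \<bullet>c u) \<le> Re (u \<bullet>c u)" .
  have "P \<alpha> *\<^sub>v (v - u) = u - P \<alpha> *\<^sub>v u"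
    unfolding u_def using A(1) v by (simp add: mult_minus_distrib_mat_vec)
  then have "0 \<le> (u - P \<alpha> *\<^sub>v u) \<bullet>c (v - u)" using A(3)[of "v - u"] u v by simp
  moreover have "(P \<alpha> *\<^sub>v u) \<bullet>c v = u \<bullet>c u"
    using cinner_hermitian[OF A(1,2) u v] by (simp add: u_def)
  ultimately have "0 \<le> u \<bullet>c v - u \<bullet>c u - (u \<bullet>c u - (P \<alpha> *\<^sub>v u) \<bullet>c u)"
    using u v Au by (simp add: cinner_minus_left[of _ n] cinner_minus_right[of _ n])
  then show ?thesis using 1 unfolding u_def by (simp add: less_eq_complex_def)
qed

text \<open>Resolving the identity with the other measurement shows that \<open>\<langle>P\<^sub>\<alpha> \<psi>, \<psi>\<rangle>\<close> and \<open>\<langle>Q\<^sub>\<alpha> \<psi>, \<psi>\<rangle>\<close> both have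
  the real part of \<open>\<langle>P\<^sub>\<alpha> \<psi>, Q\<^sub>\<alpha> \<psi>\<rangle>\<close>. With the contraction property of effects, the expansion of
  \<open>\<parallel>P\<^sub>\<alpha> \<psi> - Q\<^sub>\<alpha> \<psi>\<parallel>\<^sup>2\<close> is then at most \<open>0\<close>.\<close>

lemma consistent_povms_agree:
  assumes P: "povm n c P" and Q: "povm n c Q" and \<psi>: "\<psi> \<in> carrier_vec n"
    and orth: "\<And>\<alpha> \<beta>. \<alpha> \<in> {1..c} \<Longrightarrow> \<beta> \<in> {1..c} \<Longrightarrow> \<alpha> \<noteq> \<beta> \<Longrightarrow>
      (Q \<beta> *\<^sub>v \<psi>) \<bullet>c (P \<alpha> *\<^sub>v \<psi>) = 0"
    and \<alpha>: "\<alpha> \<in> {1..c}"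
  shows "P \<alpha> *\<^sub>v \<psi> = Q \<alpha> *\<^sub>v \<psi>"
proof -
  let ?v = "P \<alpha> *\<^sub>v \<psi>" and ?w = "Q \<alpha> *\<^sub>v \<psi>"
  have v: "?v \<in> carrier_vec n" and w: "?w \<in> carrier_vec n"
    using povmD(1)[OF P \<alpha>] povmD(1)[OF Q \<alpha>] \<psi> by auto
  have "\<psi> \<bullet>c ?v = (\<Sum>\<beta>=1..c. (Q \<beta> *\<^sub>v \<psi>) \<bullet>c ?v)"
    using povm_resolution_cinner[OF Q \<psi> v] by simp
  also have "\<dots> = ?w \<bullet>c ?v"
    using orth[OF \<alpha>] \<alpha> by (subst sum.remove[of _ \<alpha>]) auto
  finally have 1: "\<psi> \<bullet>c ?v = ?w \<bullet>c ?v" .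
  have "\<psi> \<bullet>c ?w = (\<Sum>\<beta>=1..c. (P \<beta> *\<^sub>v \<psi>) \<bullet>c ?w)"
    using povm_resolution_cinner[OF P \<psi> w] by simp
  also have "\<dots> = (\<Sum>\<beta>=1..c. if \<beta> = \<alpha> then ?v \<bullet>c ?w else 0)"
  proof (rule sum.cong)
    fix \<beta> assume b: "\<beta> \<in> {1..c}"
    then have "P \<beta> *\<^sub>v \<psi> \<in> carrier_vec n" using povmD(1)[OF P b] \<psi> by simp
    then show "(P \<beta> *\<^sub>v \<psi>) \<bullet>c ?w = (if \<beta> = \<alpha> then ?v \<bullet>c ?w else 0)"
      using orth[OF b \<alpha>] cinner_cnj[of "P \<beta> *\<^sub>v \<psi>" n ?w] w by (metis complex_cnj_zero_iff)
  qed simp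
  also have "\<dots> = ?v \<bullet>c ?w" using \<alpha> by simp
  finally have 2: "\<psi> \<bullet>c ?w = ?v \<bullet>c ?w" .
  have 3: "cnj (\<psi> \<bullet>c ?v) = ?v \<bullet>c \<psi>" "cnj (\<psi> \<bullet>c ?w) = ?w \<bullet>c \<psi>"
    "cnj (?v \<bullet>c ?w) = ?w \<bullet>c ?v"
    using v w \<psi> by (auto intro: cinner_cnj)
  have "Re (?v \<bullet>c \<psi>) = Re (?v \<bullet>c ?w)" "Re (?w \<bullet>c \<psi>) = Re (?v \<bullet>c ?w)"
    using 1 2 3 by (metis complex_cnj_cnj cnj.sel(1))+
  then have "Re (?v \<bullet>c ?v) \<le> Re (?v \<bullet>c ?w)" "Re (?w \<bullet>c ?w) \<le> Re (?v \<bullet>c ?w)"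
    using povm_effect_contraction[OF P \<alpha> \<psi>] povm_effect_contraction[OF Q \<alpha> \<psi>] by auto
  moreover have "Re (?w \<bullet>c ?v) = Re (?v \<bullet>c ?w)" using 3(3) by (metis cnj.sel(1))
  moreover have "(?v - ?w) \<bullet>c (?v - ?w) = ?v \<bullet>c ?v - ?w \<bullet>c ?v - (?v \<bullet>c ?w - ?w \<bullet>c ?w)"
    using v w by (simp add: cinner_minus_left[of _ n] cinner_minus_right[of _ n])
  ultimately have "Re ((?v - ?w) \<bullet>c (?v - ?w)) \<le> 0" by simp
  moreover have d: "?v - ?w \<in> carrier_vec n" using v w by simp
  ultimately have "(\<Sum>k<n. (cmod ((?v - ?w) $ k))\<^sup>2) \<le> 0"
    using cinner_norm[OF d] by (metis Re_complex_of_real)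
  then have "(\<Sum>k<n. (cmod ((?v - ?w) $ k))\<^sup>2) = 0"
    by (intro antisym sum_nonneg) auto
  then have "\<forall>k<n. (?v - ?w) $ k = 0"
    by (subst (asm) sum_nonneg_eq_0_iff) auto
  then have "?v $ k = ?w $ k" if "k < n" for k
    using that v w by (metis carrier_vecD eq_iff_diff_eq_0 index_minus_vec(1))
  then show ?thesis using v w by (intro eq_vecI) (metis carrier_vecD)+
qed

section \<open>Kronecker products and local measurements\<close>

lemma sum_lessThan_mult:
  "(\<Sum>k<a * b. f k) = (\<Sum>i<a. \<Sum>j<b. f (i * b + j :: nat))"
proof -
  have "(\<Sum>k<a * b. f k) = (\<Sum>i<a. sum f {i * b..<i * b + b})"
    by (rule sum.nat_group[symmetric])
  also have "\<dots> = (\<Sum>i<a. \<Sum>j<b. f (i * b + j))"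
  proof (rule sum.cong)
    fix i
    show "sum f {i * b..<i * b + b} = (\<Sum>j<b. f (i * b + j))"
      using sum.shift_bounds_nat_ivl[of f 0 "i * b" b] by (simp add: add.commute atLeast0LessThan)
  qed simp
  finally show ?thesis .
qed

lemma pair_index_less: "i < a \<Longrightarrow> j < b \<Longrightarrow> i * b + j < a * (b :: nat)"
proof -
  assume "i < a" "j < b"
  then have "i * b + j < Suc i * b" by simp
  also have "\<dots> \<le> a * b" using \<open>i < a\<close> by (intro mult_le_mono1) simp
  finally show ?thesis .
qed

lemma kronecker_carrier:
  "A \<in> carrier_mat a a' \<Longrightarrow> B \<in> carrier_mat b b' \<Longrightarrow> kronecker A B \<in> carrier_mat (a * b) (a' * b')"
  by (auto simp: kronecker_def)

lemma kronecker_index: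
  assumes "A \<in> carrier_mat a a'" "B \<in> carrier_mat b b'" "i < a * b" "j < a' * b'"
  shows "kronecker A B $$ (i, j) = A $$ (i div b, j div b') * B $$ (i mod b, j mod b')"
  using assms by (auto simp: kronecker_def)

lemma kronecker_mult:
  assumes A: "A \<in> carrier_mat a a" "C \<in> carrier_mat a a"
    and B: "B \<in> carrier_mat b b" "D \<in> carrier_mat b b"
  shows "kronecker A B * kronecker C D = kronecker (A * C) (B * D)"
proof (rule eq_matI)
  fix i j assume "i < dim_row (kronecker (A * C) (B * D))" "j < dim_col (kronecker (A * C) (B * D))"
  then have ij: "i < a * b" "j < a * b" using assms by (auto simp: kronecker_def)
  then have b: "i mod b < b" "j mod b < b" "i div b < a" "j div b < a"
    by (auto simp: less_mult_imp_div_less intro!: mod_less_divisor gr0I)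
  have "(kronecker A B * kronecker C D) $$ (i, j)
    = (\<Sum>k<a * b. kronecker A B $$ (i, k) * kronecker C D $$ (k, j))"
    using ij kronecker_carrier[OF A(1) B(1)] kronecker_carrier[OF A(2) B(2)]
    by (simp add: scalar_prod_def atLeast0LessThan)
  also have "\<dots> = (\<Sum>k<a. \<Sum>l<b. (A $$ (i div b, k) * C $$ (k, j div b))
      * (B $$ (i mod b, l) * D $$ (l, j mod b)))"
    unfolding sum_lessThan_mult using ij
    by (intro sum.cong refl)
      (simp add: kronecker_index[OF A(1) B(1)] kronecker_index[OF A(2) B(2)] pair_index_less)
  also have "\<dots> = (A * C) $$ (i div b, j div b) * (B * D) $$ (i mod b, j mod b)"
    using b assms by (simp add: sum_product scalar_prod_def atLeast0LessThan)
  also have "\<dots> = kronecker (A * C) (B * D) $$ (i, j)"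
    using ij assms kronecker_index[of "A * C" a a "B * D" b b i j] by simp
  finally show "(kronecker A B * kronecker C D) $$ (i, j) = kronecker (A * C) (B * D) $$ (i, j)" .
qed (use assms in \<open>auto simp: kronecker_def\<close>)

lemma kronecker_adjoint:
  assumes A: "A \<in> carrier_mat a a" and B: "B \<in> carrier_mat b b"
  shows "mat_adjoint (kronecker A B) = kronecker (mat_adjoint A) (mat_adjoint B)"
proof (rule eq_matI)
  note K = kronecker_carrier[OF A B]
  note K' = kronecker_carrier[OF mat_adjoint_carrier[OF A] mat_adjoint_carrier[OF B]]
  fix i j assume "i < dim_row (kronecker (mat_adjoint A) (mat_adjoint B))"
    "j < dim_col (kronecker (mat_adjoint A) (mat_adjoint B))"
  then have ij: "i < a * b" "j < a * b" using K' by auto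
  then have b: "i mod b < b" "j mod b < b" "i div b < a" "j div b < a"
    by (auto simp: less_mult_imp_div_less intro!: mod_less_divisor gr0I)
  show "mat_adjoint (kronecker A B) $$ (i, j) = kronecker (mat_adjoint A) (mat_adjoint B) $$ (i, j)"
    using ij b mat_adjoint_index[OF K ij] kronecker_index[OF A B ij(2,1)]
      kronecker_index[OF mat_adjoint_carrier[OF A] mat_adjoint_carrier[OF B] ij]
      mat_adjoint_index[OF A b(3,4)] mat_adjoint_index[OF B b(1,2)] by simp
qed (use mat_adjoint_carrier[OF kronecker_carrier[OF A B]]
  kronecker_carrier[OF mat_adjoint_carrier[OF A] mat_adjoint_carrier[OF B]] in auto)

lemma kronecker_cinner:
  assumes A: "A \<in> carrier_mat a a" and B: "B \<in> carrier_mat b b"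
    and \<psi>: "\<psi> \<in> carrier_vec (a * b)" "\<phi> \<in> carrier_vec (a * b)"
  shows "(kronecker A B *\<^sub>v \<psi>) \<bullet>c \<phi> = (\<Sum>i<a. \<Sum>j<b. \<Sum>k<a. \<Sum>l<b.
    A $$ (i, k) * B $$ (j, l) * \<psi> $ (k * b + l) * cnj (\<phi> $ (i * b + j)))"
proof -
  note K = kronecker_carrier[OF A B]
  have "(kronecker A B *\<^sub>v \<psi>) \<bullet>c \<phi>
    = (\<Sum>m<a * b. \<Sum>n<a * b. kronecker A B $$ (m, n) * \<psi> $ n * cnj (\<phi> $ m))"
    using K \<psi> by (simp add: cinner_sum[of _ "a * b"] mult_mat_vec_sum[OF K] sum_distrib_right
        del: index_mult_mat_vec)
  then show ?thesis
    unfolding sum_lessThan_mult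
    by (simp add: kronecker_index[OF A B] pair_index_less)
qed

lemma mat_adjoint_one: "mat_adjoint (1\<^sub>m b :: complex mat) = 1\<^sub>m b"
  by (rule eq_matI) (use mat_adjoint_index[of "1\<^sub>m b" b b] mat_adjoint_carrier[of "1\<^sub>m b" b b] in auto)

text \<open>Positivity of \<open>E \<otimes> 1\<close> comes from cutting a vector of \<open>\<complex>\<^sup>a \<otimes> \<complex>\<^sup>b\<close> into \<open>b\<close> slices, on each of which
  \<open>E\<close> acts.\<close>

lemma povm_kronecker_left:
  assumes E: "povm a c E"
  shows "povm (a * b) c (\<lambda>\<alpha>. kronecker (E \<alpha>) (1\<^sub>m b))"
proof -
  have "0 \<le> (kronecker (E \<alpha>) (1\<^sub>m b) *\<^sub>v v) \<bullet>c v"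
    if \<alpha>: "\<alpha> \<in> {1..c}" and v: "v \<in> carrier_vec (a * b)" for \<alpha> v
  proof -
    note A = povmD[OF E \<alpha>]
    let ?v = "\<lambda>j. vec a (\<lambda>i. v $ (i * b + j))"
    have "(kronecker (E \<alpha>) (1\<^sub>m b) *\<^sub>v v) \<bullet>c v = (\<Sum>i<a. \<Sum>j<b. \<Sum>k<a. \<Sum>l<b.
      if j = l then E \<alpha> $$ (i, k) * v $ (k * b + l) * cnj (v $ (i * b + j)) else 0)"
      unfolding kronecker_cinner[OF A(1) one_carrier_mat v v] by (intro sum.cong) auto
    also have "\<dots> = (\<Sum>j<b. \<Sum>i<a. \<Sum>k<a. E \<alpha> $$ (i, k) * v $ (k * b + j) * cnj (v $ (i * b + j)))"
      by (subst sum.swap) simp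
    also have "\<dots> = (\<Sum>j<b. (E \<alpha> *\<^sub>v ?v j) \<bullet>c ?v j)"
      using A(1) by (simp add: cinner_sum[of _ a] mult_mat_vec_sum[OF A(1)] sum_distrib_right
          del: index_mult_mat_vec)
    also have "\<dots> \<ge> 0" by (intro sum_nonneg A(3)) auto
    finally show ?thesis .
  qed
  moreover have "mat (a * b) (a * b) (\<lambda>ij. \<Sum>\<alpha>=1..c. kronecker (E \<alpha>) (1\<^sub>m b) $$ ij) = 1\<^sub>m (a * b)"
  proof (rule eq_matI)
    fix i j assume "i < dim_row (1\<^sub>m (a * b) :: complex mat)" "j < dim_col (1\<^sub>m (a * b) :: complex mat)"
    then have ij: "i < a * b" "j < a * b" by auto
    then have b: "i mod b < b" "j mod b < b" "i div b < a" "j div b < a"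
      by (auto simp: less_mult_imp_div_less intro!: mod_less_divisor gr0I)
    have "mat a a (\<lambda>ij. \<Sum>\<alpha>=1..c. E \<alpha> $$ ij) $$ (i div b, j div b) = 1\<^sub>m a $$ (i div b, j div b)"
      using E by (simp add: povm_def)
    then have s: "(\<Sum>\<alpha>=1..c. E \<alpha> $$ (i div b, j div b)) = (if i div b = j div b then 1 else 0)"
      using b by simp
    have "(\<Sum>\<alpha>=1..c. kronecker (E \<alpha>) (1\<^sub>m b) $$ (i, j))
      = (\<Sum>\<alpha>=1..c. E \<alpha> $$ (i div b, j div b) * 1\<^sub>m b $$ (i mod b, j mod b))"
      using kronecker_index[OF povmD(1)[OF E] one_carrier_mat ij] by (intro sum.cong) auto
    also have "\<dots> = (if i = j then 1 else 0)"
      unfolding sum_distrib_right[symmetric] s using b by simp (metis div_mult_mod_eq)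
    finally show "mat (a * b) (a * b) (\<lambda>ij. \<Sum>\<alpha>=1..c. kronecker (E \<alpha>) (1\<^sub>m b) $$ ij) $$ (i, j)
      = 1\<^sub>m (a * b) $$ (i, j)" using ij by simp
  qed auto
  moreover have "mat_adjoint (kronecker (E \<alpha>) (1\<^sub>m b)) = kronecker (E \<alpha>) (1\<^sub>m b)" if "\<alpha> \<in> {1..c}" for \<alpha>
    using povmD(1,2)[OF E that] by (simp add: kronecker_adjoint[where a = a and b = b] mat_adjoint_one)
  moreover have "kronecker (E \<alpha>) (1\<^sub>m b) \<in> carrier_mat (a * b) (a * b)" if "\<alpha> \<in> {1..c}" for \<alpha>
    using povmD(1)[OF E that] by (intro kronecker_carrier) simp_all
  ultimately show ?thesis
    unfolding povm_def pos_semidef_def by blast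
qed

lemma povm_kronecker_right:
  assumes F: "povm b c F"
  shows "povm (a * b) c (\<lambda>\<alpha>. kronecker (1\<^sub>m a) (F \<alpha>))"
proof -
  have "0 \<le> (kronecker (1\<^sub>m a) (F \<alpha>) *\<^sub>v v) \<bullet>c v"
    if \<alpha>: "\<alpha> \<in> {1..c}" and v: "v \<in> carrier_vec (a * b)" for \<alpha> v
  proof -
    note A = povmD[OF F \<alpha>]
    let ?v = "\<lambda>i. vec b (\<lambda>j. v $ (i * b + j))"
    have "(kronecker (1\<^sub>m a) (F \<alpha>) *\<^sub>v v) \<bullet>c v = (\<Sum>i<a. \<Sum>j<b. \<Sum>k<a. \<Sum>l<b.
      if i = k then F \<alpha> $$ (j, l) * v $ (k * b + l) * cnj (v $ (i * b + j)) else 0)"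
      unfolding kronecker_cinner[OF one_carrier_mat A(1) v v] by (intro sum.cong) auto
    also have "\<dots> = (\<Sum>i<a. \<Sum>j<b. \<Sum>l<b. F \<alpha> $$ (j, l) * v $ (i * b + l) * cnj (v $ (i * b + j)))"
    proof (rule sum.cong[OF refl], rule sum.cong[OF refl])
      fix i j assume "i \<in> {..<a}"
      then show "(\<Sum>k<a. \<Sum>l<b. if i = k then F \<alpha> $$ (j, l) * v $ (k * b + l) * cnj (v $ (i * b + j)) else 0)
        = (\<Sum>l<b. F \<alpha> $$ (j, l) * v $ (i * b + l) * cnj (v $ (i * b + j)))"
        by (subst sum.swap) simp
    qed
    also have "\<dots> = (\<Sum>i<a. (F \<alpha> *\<^sub>v ?v i) \<bullet>c ?v i)"
      using A(1) by (simp add: cinner_sum[of _ b] mult_mat_vec_sum[OF A(1)] sum_distrib_right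
          del: index_mult_mat_vec)
    also have "\<dots> \<ge> 0" by (intro sum_nonneg A(3)) auto
    finally show ?thesis .
  qed
  moreover have "mat (a * b) (a * b) (\<lambda>ij. \<Sum>\<alpha>=1..c. kronecker (1\<^sub>m a) (F \<alpha>) $$ ij) = 1\<^sub>m (a * b)"
  proof (rule eq_matI)
    fix i j assume "i < dim_row (1\<^sub>m (a * b) :: complex mat)" "j < dim_col (1\<^sub>m (a * b) :: complex mat)"
    then have ij: "i < a * b" "j < a * b" by auto
    then have b: "i mod b < b" "j mod b < b" "i div b < a" "j div b < a"
      by (auto simp: less_mult_imp_div_less intro!: mod_less_divisor gr0I)
    have "mat b b (\<lambda>ij. \<Sum>\<alpha>=1..c. F \<alpha> $$ ij) $$ (i mod b, j mod b) = 1\<^sub>m b $$ (i mod b, j mod b)"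
      using F by (simp add: povm_def)
    then have s: "(\<Sum>\<alpha>=1..c. F \<alpha> $$ (i mod b, j mod b)) = (if i mod b = j mod b then 1 else 0)"
      using b by simp
    have "(\<Sum>\<alpha>=1..c. kronecker (1\<^sub>m a) (F \<alpha>) $$ (i, j))
      = (\<Sum>\<alpha>=1..c. 1\<^sub>m a $$ (i div b, j div b) * F \<alpha> $$ (i mod b, j mod b))"
      using kronecker_index[OF one_carrier_mat povmD(1)[OF F] ij] by (intro sum.cong) auto
    also have "\<dots> = (if i = j then 1 else 0)"
      unfolding sum_distrib_left[symmetric] s using b by simp (metis div_mult_mod_eq)
    finally show "mat (a * b) (a * b) (\<lambda>ij. \<Sum>\<alpha>=1..c. kronecker (1\<^sub>m a) (F \<alpha>) $$ ij) $$ (i, j)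
      = 1\<^sub>m (a * b) $$ (i, j)" using ij by simp
  qed auto
  moreover have "mat_adjoint (kronecker (1\<^sub>m a) (F \<alpha>)) = kronecker (1\<^sub>m a) (F \<alpha>)" if "\<alpha> \<in> {1..c}" for \<alpha>
    using povmD(1,2)[OF F that] by (simp add: kronecker_adjoint[where a = a and b = b] mat_adjoint_one)
  moreover have "kronecker (1\<^sub>m a) (F \<alpha>) \<in> carrier_mat (a * b) (a * b)" if "\<alpha> \<in> {1..c}" for \<alpha>
    using povmD(1)[OF F that] by (intro kronecker_carrier) simp_all
  ultimately show ?thesis
    unfolding povm_def pos_semidef_def by blast
qed

text \<open>The two local measurements are moved to opposite sides of the inner product, so that only
  the vectors \<open>(E \<otimes> 1) \<psi>\<close> and \<open>(1 \<otimes> F) \<psi>\<close> matter from here on.\<close>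

lemma outcome_prob_cinner:
  assumes A: "A \<in> carrier_mat a a" "mat_adjoint A = A" and B: "B \<in> carrier_mat b b"
    and \<psi>: "\<psi> \<in> carrier_vec (a * b)"
  shows "outcome_prob \<psi> A B
    = (kronecker (1\<^sub>m a) B *\<^sub>v \<psi>) \<bullet>c (kronecker A (1\<^sub>m b) *\<^sub>v \<psi>)"
proof -
  let ?A = "kronecker A (1\<^sub>m b)" and ?B = "kronecker (1\<^sub>m a) B"
  have c: "?A \<in> carrier_mat (a * b) (a * b)" "?B \<in> carrier_mat (a * b) (a * b)"
    using A B by (auto intro!: kronecker_carrier)
  have "kronecker A B = ?A * ?B"
    using A B by (simp add: kronecker_mult[where a = a and b = b])
  then have "outcome_prob \<psi> A B = (?A *\<^sub>v (?B *\<^sub>v \<psi>)) \<bullet>c \<psi>"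
    using c \<psi> by (simp add: outcome_prob_def)
  also have "\<dots> = (?B *\<^sub>v \<psi>) \<bullet>c (?A *\<^sub>v \<psi>)"
    using c \<psi> A by (intro cinner_hermitian[of _ "a * b"])
      (auto simp: kronecker_adjoint[OF _ one_carrier_mat] mat_adjoint_one)
  finally show ?thesis .
qed

section \<open>Walsh characters and the spectrum of the Hadamard graph\<close>

definition walsh :: "nat set \<Rightarrow> int vec \<Rightarrow> int" where
  "walsh S x = (\<Prod>i\<in>S. x $ i)"

definition entrywise_mult :: "nat \<Rightarrow> int vec \<Rightarrow> int vec \<Rightarrow> int vec" where
  "entrywise_mult N x y = vec N (\<lambda>i. x $ i * y $ i)"

definition balanced_vectors :: "nat \<Rightarrow> int vec set" where
  "balanced_vectors N = {z \<in> sign_vectors N. (\<Sum>i<N. z $ i) = 0}"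

text \<open>The eigenvalue of the adjacency matrix at the character \<open>walsh S\<close>, a value of a Krawtchouk
  polynomial: two sign vectors are adjacent exactly when their entrywise product is balanced, so
  the adjacency operator is convolution with the indicator function of the balanced vectors.\<close>

definition hadamard_eigenvalue :: "nat \<Rightarrow> nat set \<Rightarrow> int" where
  "hadamard_eigenvalue N S = (\<Sum>z\<in>balanced_vectors N. walsh S z)"

lemma sign_vectors_entry: "x \<in> sign_vectors N \<Longrightarrow> i < N \<Longrightarrow> x $ i = 1 \<or> x $ i = - 1"
  by (simp add: sign_vectors_def)

lemma sign_vectors_square: "x \<in> sign_vectors N \<Longrightarrow> i < N \<Longrightarrow> x $ i * x $ i = 1"
  using sign_vectors_entry by fastforce

lemma finite_balanced_vectors: "finite (balanced_vectors N)"
  using card_sign_vectors[of N] by (simp add: balanced_vectors_def)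

lemma entrywise_mult_sign:
  "x \<in> sign_vectors N \<Longrightarrow> y \<in> sign_vectors N \<Longrightarrow> entrywise_mult N x y \<in> sign_vectors N"
  unfolding entrywise_mult_def sign_vectors_def by fastforce

lemma walsh_entrywise_mult:
  assumes "S \<subseteq> {..<N}"
  shows "walsh S (entrywise_mult N x y) = walsh S x * walsh S y"
  unfolding walsh_def prod.distrib[symmetric]
  using assms by (intro prod.cong) (auto simp: entrywise_mult_def)

lemma sum_walsh:
  assumes x: "x \<in> sign_vectors N"
  shows "(\<Sum>S\<in>Pow {..<N}. walsh S x) = (if \<forall>i<N. x $ i = 1 then 2 ^ N else 0)"
proof -
  have "(\<Sum>S\<in>Pow {..<N}. walsh S x) = (\<Prod>i<N. x $ i + 1)"
    using prod_add[of "{..<N}" "\<lambda>i. x $ i" "\<lambda>_. 1"] by (simp add: walsh_def)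
  also have "\<dots> = (if \<forall>i<N. x $ i = 1 then 2 ^ N else 0)"
  proof (cases "\<forall>i<N. x $ i = 1")
    case False
    then obtain i where "i < N" "x $ i = - 1" using sign_vectors_entry[OF x] by blast
    then have "\<exists>i\<in>{..<N}. x $ i + 1 = 0" by (intro bexI[of _ i]) auto
    then show ?thesis using False prod_zero[of "{..<N}" "\<lambda>i. x $ i + 1"] by simp
  qed simp
  finally show ?thesis .
qed

lemma walsh_orthogonality:
  assumes x: "x \<in> sign_vectors N" and y: "y \<in> sign_vectors N"
  shows "(\<Sum>S\<in>Pow {..<N}. walsh S x * walsh S y) = (if x = y then 2 ^ N else 0)"
proof -
  have "x $ i * y $ i = 1 \<longleftrightarrow> x $ i = y $ i" if "i < N" for i
    using sign_vectors_entry[OF x that] sign_vectors_entry[OF y that] by auto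
  then have "(\<forall>i<N. entrywise_mult N x y $ i = 1) \<longleftrightarrow> (\<forall>i<N. x $ i = y $ i)"
    by (auto simp: entrywise_mult_def)
  also have "\<dots> \<longleftrightarrow> x = y" using x y by (auto simp: sign_vectors_def)
  finally have *: "(\<forall>i<N. entrywise_mult N x y $ i = 1) \<longleftrightarrow> x = y" .
  have "(\<Sum>S\<in>Pow {..<N}. walsh S x * walsh S y) = (\<Sum>S\<in>Pow {..<N}. walsh S (entrywise_mult N x y))"
    by (intro sum.cong) (auto simp: walsh_entrywise_mult)
  then show ?thesis by (simp only: sum_walsh[OF entrywise_mult_sign[OF x y]] *)
qed

text \<open>Spectral decomposition of the adjacency matrix: writing \<open>w\<close> for the entrywise product of \<open>x\<close> and
  \<open>y\<close>, orthogonality of the characters turns the left-hand side into \<open>2\<^sup>N\<close> times the number of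
  balanced \<open>z\<close> with \<open>z = w\<close>.\<close>

lemma walsh_expansion_adjacency:
  assumes x: "x \<in> sign_vectors N" and y: "y \<in> sign_vectors N"
  shows "(\<Sum>S\<in>Pow {..<N}. hadamard_eigenvalue N S * (walsh S x * walsh S y))
    = (if x \<bullet> y = 0 then 2 ^ N else 0)"
proof -
  let ?w = "entrywise_mult N x y"
  have w: "?w \<in> sign_vectors N" by (rule entrywise_mult_sign[OF x y])
  have "(\<Sum>i<N. ?w $ i) = x \<bullet> y"
    using y by (auto simp: entrywise_mult_def scalar_prod_def sign_vectors_def atLeast0LessThan)
  then have b: "?w \<in> balanced_vectors N \<longleftrightarrow> x \<bullet> y = 0"
    using w by (simp add: balanced_vectors_def)
  have "(\<Sum>S\<in>Pow {..<N}. hadamard_eigenvalue N S * (walsh S x * walsh S y))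
    = (\<Sum>S\<in>Pow {..<N}. \<Sum>z\<in>balanced_vectors N. walsh S z * walsh S ?w)"
    by (intro sum.cong) (auto simp: hadamard_eigenvalue_def sum_distrib_right walsh_entrywise_mult)
  also have "\<dots> = (\<Sum>z\<in>balanced_vectors N. \<Sum>S\<in>Pow {..<N}. walsh S z * walsh S ?w)"
    by (rule sum.swap)
  also have "\<dots> = (\<Sum>z\<in>balanced_vectors N. if z = ?w then 2 ^ N else 0)"
    by (intro sum.cong refl walsh_orthogonality w) (simp add: balanced_vectors_def)
  also have "\<dots> = (if x \<bullet> y = 0 then 2 ^ N else 0)"
    using b finite_balanced_vectors by simp
  finally show ?thesis .
qed

section \<open>A lower bound for the eigenvalues\<close>

lemma hadamard_eigenvalue_empty: "hadamard_eigenvalue N {} = int (card (balanced_vectors N))"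
  by (simp add: hadamard_eigenvalue_def walsh_def)

text \<open>Multiplying a character by \<open>z\<^sub>i\<close> adds \<open>i\<close> to \<open>S\<close> or removes it, because \<open>z\<^sub>i\<^sup>2 = 1\<close>. The relation is
  the identity \<open>\<Sum>i<N. z\<^sub>i = 0\<close> of balanced vectors, multiplied by \<open>walsh S z\<close> and summed over \<open>z\<close>.\<close>

lemma hadamard_eigenvalue_neighbour_sum:
  assumes S: "S \<subseteq> {..<N}"
  shows "(\<Sum>i\<in>S. hadamard_eigenvalue N (S - {i}))
    + (\<Sum>i\<in>{..<N} - S. hadamard_eigenvalue N (insert i S)) = 0"
proof -
  have fin: "finite S" using S finite_subset by blast
  have 1: "walsh (S - {i}) z = z $ i * walsh S z" if "i \<in> S" "z \<in> balanced_vectors N" for i z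
  proof -
    have "z $ i * walsh S z = (z $ i * z $ i) * walsh (S - {i}) z"
      using fin that(1) by (simp add: walsh_def prod.remove[of S i])
    then show ?thesis using that S sign_vectors_square[of z N i] by (auto simp: balanced_vectors_def)
  qed
  have 2: "walsh (insert i S) z = z $ i * walsh S z" if "i \<notin> S" for i z
    using fin that by (simp add: walsh_def)
  have "(\<Sum>i\<in>S. hadamard_eigenvalue N (S - {i}))
    + (\<Sum>i\<in>{..<N} - S. hadamard_eigenvalue N (insert i S))
    = (\<Sum>i\<in>S. \<Sum>z\<in>balanced_vectors N. z $ i * walsh S z)
    + (\<Sum>i\<in>{..<N} - S. \<Sum>z\<in>balanced_vectors N. z $ i * walsh S z)"
    by (simp add: hadamard_eigenvalue_def 1 2)
  also have "\<dots> = (\<Sum>i<N. \<Sum>z\<in>balanced_vectors N. z $ i * walsh S z)"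
    by (subst sum.subset_diff[OF S]) (simp_all add: add.commute)
  also have "\<dots> = (\<Sum>z\<in>balanced_vectors N. (\<Sum>i<N. z $ i) * walsh S z)"
    unfolding sum_distrib_right by (rule sum.swap)
  also have "\<dots> = 0" by (simp add: balanced_vectors_def)
  finally show ?thesis .
qed

text \<open>Exchanging the coordinates \<open>k\<close> and \<open>l\<close> permutes the balanced vectors and fixes \<open>S\<close>.\<close>

lemma hadamard_eigenvalue_insert_eq:
  assumes S: "S \<subseteq> {..<N}" and k: "k < N" "k \<notin> S" and l: "l < N" "l \<notin> S"
  shows "hadamard_eigenvalue N (insert k S) = hadamard_eigenvalue N (insert l S)"
proof -
  let ?\<tau> = "transpose k l"
  let ?p = "\<lambda>z. vec N (\<lambda>i. z $ ?\<tau> i) :: int vec"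
  have \<tau>: "?\<tau> i < N \<longleftrightarrow> i < N" for i using k l by (auto simp: transpose_def)
  have bij: "bij_betw ?\<tau> {..<N} {..<N}"
    by (rule bij_betw_byWitness[of _ ?\<tau>]) (auto simp: \<tau>)
  have p: "?p z \<in> balanced_vectors N" if "z \<in> balanced_vectors N" for z
    using that sum.reindex_bij_betw[OF bij, of "\<lambda>i. z $ i"]
    by (auto simp: balanced_vectors_def sign_vectors_def \<tau>)
  have pp: "?p (?p z) = z" if "z \<in> balanced_vectors N" for z
    using that by (intro eq_vecI) (auto simp: \<tau> balanced_vectors_def sign_vectors_def)
  have w: "walsh (insert l S) (?p z) = walsh (insert k S) z" for z
  proof -
    have "walsh (insert l S) (?p z) = (\<Prod>i\<in>insert l S. z $ ?\<tau> i)"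
      unfolding walsh_def using S l by (intro prod.cong) auto
    also have "\<dots> = (\<Prod>i\<in>insert k S. z $ i)"
    proof (rule prod.reindex_bij_betw)
      show "bij_betw ?\<tau> (insert l S) (insert k S)"
        using k l by (intro bij_betw_byWitness[of _ ?\<tau>]) (auto simp: transpose_def)
    qed
    finally show ?thesis by (simp add: walsh_def)
  qed
  show ?thesis
    unfolding hadamard_eigenvalue_def
    by (rule sum.reindex_bij_witness[of _ ?p ?p]) (auto simp: p pp w)
qed

text \<open>The recursion that drives the eigenvalue bound: by symmetry the second sum in
  \<open>hadamard_eigenvalue_neighbour_sum\<close> has \<open>N - card S\<close> equal terms.\<close>

lemma hadamard_eigenvalue_insert:
  assumes S: "S \<subseteq> {..<N}" and k: "k < N" "k \<notin> S"
  shows "(int N - int (card S)) * hadamard_eigenvalue N (insert k S)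
    = - (\<Sum>i\<in>S. hadamard_eigenvalue N (S - {i}))"
proof -
  have "(\<Sum>i\<in>{..<N} - S. hadamard_eigenvalue N (insert i S))
    = (\<Sum>i\<in>{..<N} - S. hadamard_eigenvalue N (insert k S))"
    using S k by (intro sum.cong refl hadamard_eigenvalue_insert_eq) auto
  also have "\<dots> = (int N - int (card S)) * hadamard_eigenvalue N (insert k S)"
  proof -
    have "card S \<le> N" using S card_mono[of "{..<N}" S] by simp
    then show ?thesis using S by (simp add: card_Diff_subset finite_subset[OF S] of_nat_diff)
  qed
  finally show ?thesis using hadamard_eigenvalue_neighbour_sum[OF S] by simp
qed

text \<open>Induction on the size along \<open>hadamard_eigenvalue_insert\<close>. The recursion gives \<open>0\<close> for singletons
  and exactly \<open>- C / (N - 1)\<close> for pairs. Going from sets of sizes \<open>j - 1\<close> to sets of size \<open>j + 1\<close>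
  multiplies the bound by \<open>j / (N - j)\<close>, which is at most \<open>1\<close> as long as \<open>2 j \<le> N\<close>; hence the
  restriction on the size.\<close>

lemma abs_hadamard_eigenvalue_le:
  assumes "S \<subseteq> {..<N}" "S \<noteq> {}" "2 * card S \<le> N + 2"
  shows "(int N - 1) * \<bar>hadamard_eigenvalue N S\<bar> \<le> int (card (balanced_vectors N))"
  using assms
proof (induction "card S" arbitrary: S rule: less_induct)
  case less
  obtain k T where S: "S = insert k T" "k \<notin> T" using less.prems(2) by (meson mk_disjoint_insert ex_in_conv)
  have T: "T \<subseteq> {..<N}" "k < N" using S less.prems by auto
  have finT: "finite T" using T finite_subset by blast
  have cS: "card S = Suc (card T)" using S finT by simp
  note rec = hadamard_eigenvalue_insert[OF T S(2), folded S(1)]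
  let ?C = "int (card (balanced_vectors N))" and ?e = "hadamard_eigenvalue N"
  consider "card T = 0" | "card T = 1" | "card T \<ge> 2" by linarith
  then show ?case
  proof cases
    case 1
    then have "T = {}" using finT by simp
    then show ?thesis using rec T by simp
  next
    case 2
    then obtain i where "T = {i}" by (auto simp: card_1_singleton_iff)
    then have "(int N - 1) * ?e S = - ?C" using rec by (simp add: hadamard_eigenvalue_empty)
    then have "\<bar>int N - 1\<bar> * \<bar>?e S\<bar> = ?C" by (metis abs_minus_cancel abs_mult abs_of_nat)
    then show ?thesis using T by simp
  next
    case 3
    let ?j = "int (card T)"
    have j: "2 * ?j \<le> int N" using less.prems(3) cS by simp
    have IH: "(int N - 1) * \<bar>?e (T - {i})\<bar> \<le> ?C" if i: "i \<in> T" for i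
    proof (rule less.hyps)
      have c: "card (T - {i}) = card T - 1" using i finT by simp
      show "card (T - {i}) < card S" "2 * card (T - {i}) \<le> N + 2"
        using c cS less.prems(3) by simp_all
      show "T - {i} \<noteq> {}"
        using c 3 by (metis Suc_1 card.empty diff_is_0_eq not_less_eq_eq)
    qed (use T in auto)
    have "\<bar>(int N - ?j) * ?e S\<bar> = \<bar>\<Sum>i\<in>T. ?e (T - {i})\<bar>"
      using rec by simp
    moreover have "\<bar>(int N - ?j) * ?e S\<bar> = (int N - ?j) * \<bar>?e S\<bar>"
      using j by (simp add: abs_mult)
    ultimately have "(int N - ?j) * \<bar>?e S\<bar> = \<bar>\<Sum>i\<in>T. ?e (T - {i})\<bar>" by simp
    also have "\<dots> \<le> (\<Sum>i\<in>T. \<bar>?e (T - {i})\<bar>)" by (rule sum_abs)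
    finally have "(int N - 1) * ((int N - ?j) * \<bar>?e S\<bar>) \<le> (int N - 1) * (\<Sum>i\<in>T. \<bar>?e (T - {i})\<bar>)"
      using T by (intro mult_left_mono) auto
    also have "\<dots> \<le> (\<Sum>i\<in>T. ?C)"
      unfolding sum_distrib_left by (intro sum_mono IH)
    also have "\<dots> = ?j * ?C" by simp
    also have "\<dots> \<le> (int N - ?j) * ?C" using j by (intro mult_right_mono) auto
    finally have "(int N - ?j) * ((int N - 1) * \<bar>?e S\<bar>) \<le> (int N - ?j) * ?C"
      by (simp add: mult.left_commute)
    then show ?thesis using j 3 by (subst (asm) mult_le_cancel_left_pos) auto
  qed
qed

text \<open>A balanced vector has exactly \<open>N / 2\<close> entries \<open>-1\<close>, an even number. This is where divisibility
  by \<open>4\<close>, rather than by \<open>2\<close>, enters: otherwise the eigenvalue at \<open>{..<N}\<close> would be \<open>- C\<close>.\<close>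

lemma prod_balanced_vector:
  assumes z: "z \<in> balanced_vectors N" and N: "4 dvd N"
  shows "(\<Prod>i<N. z $ i) = 1"
proof -
  let ?M = "{i \<in> {..<N}. z $ i = - 1}"
  have e: "z $ i = 1 \<or> z $ i = - 1" if "i < N" for i
    using z that sign_vectors_entry[of z N i] by (simp add: balanced_vectors_def)
  have "(\<Sum>i<N. z $ i) = (\<Sum>i<N. 1 - 2 * (if i \<in> ?M then 1 else 0))"
    by (intro sum.cong refl) (use e in force)
  also have "\<dots> = int N - 2 * int (card ?M)"
    by (simp add: sum_subtractf sum_distrib_left[symmetric] sum.If_cases Int_def)
  finally have "N = 2 * card ?M" using z by (simp add: balanced_vectors_def)
  then have even: "even (card ?M)" using N by presburger
  have "(\<Prod>i<N. z $ i) = (\<Prod>i<N. if i \<in> ?M then - 1 else 1)"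
    by (intro prod.cong refl) (use e in force)
  also have "\<dots> = (- 1) ^ card ?M"
    by (simp add: prod.If_cases Int_def)
  finally show ?thesis using even by simp
qed

lemma hadamard_eigenvalue_complement:
  assumes N: "4 dvd N" and S: "S \<subseteq> {..<N}"
  shows "hadamard_eigenvalue N ({..<N} - S) = hadamard_eigenvalue N S"
  unfolding hadamard_eigenvalue_def
proof (rule sum.cong[OF refl])
  fix z assume z: "z \<in> balanced_vectors N"
  have "walsh S z * walsh S z = 1"
    unfolding walsh_def prod.distrib[symmetric]
    using S z sign_vectors_square[of z N] by (intro prod.neutral) (auto simp: balanced_vectors_def)
  moreover have "walsh ({..<N} - S) z * walsh S z = 1"
    using prod_balanced_vector[OF z N] prod.subset_diff[OF S, of "\<lambda>i. z $ i"] by (simp add: walsh_def)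
  ultimately show "walsh ({..<N} - S) z = walsh S z"
    by (metis mult_cancel_right zero_neq_one mult_zero_right)
qed

text \<open>Of \<open>S\<close> and its complement, one is small enough for \<open>abs_hadamard_eigenvalue_le\<close>. The exception
  is \<open>S = {..<N}\<close>, whose complement is empty; there the eigenvalue is \<open>C\<close>, which is nonnegative.\<close>

lemma hadamard_eigenvalue_ge:
  assumes N: "4 dvd N" and S: "S \<subseteq> {..<N}" "S \<noteq> {}"
  shows "- int (card (balanced_vectors N)) \<le> (int N - 1) * hadamard_eigenvalue N S"
proof -
  let ?C = "int (card (balanced_vectors N))" and ?e = "hadamard_eigenvalue N"
  have pos: "0 < N" using S by auto
  have *: "- ?C \<le> (int N - 1) * ?e T"
    if T: "T \<subseteq> {..<N}" "T \<noteq> {}" "2 * card T \<le> N + 2" for T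
  proof -
    have "- \<bar>?e T\<bar> \<le> ?e T" by simp
    then have "(int N - 1) * - \<bar>?e T\<bar> \<le> (int N - 1) * ?e T"
      using pos by (intro mult_left_mono) auto
    then show ?thesis using abs_hadamard_eigenvalue_le[OF T] by simp
  qed
  show ?thesis
  proof (cases "2 * card S \<le> N + 2")
    case False
    let ?T = "{..<N} - S"
    have "card ?T = N - card S" using S by (simp add: card_Diff_subset finite_subset)
    then have c: "2 * card ?T \<le> N + 2" using False by simp
    have "- ?C \<le> (int N - 1) * ?e ?T"
    proof (cases "?T = {}")
      case True
      have "0 \<le> (int N - 1) * ?C" using pos by (intro mult_nonneg_nonneg) auto
      then show ?thesis unfolding True hadamard_eigenvalue_empty by linarith
    qed (use * c in auto)
    then show ?thesis by (simp only: hadamard_eigenvalue_complement[OF N S(1)])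
  qed (use * S in auto)
qed

lemma balanced_vectors_nonempty:
  assumes "even N"
  shows "balanced_vectors N \<noteq> {}"
proof -
  obtain m where m: "N = 2 * m" using assms by blast
  let ?z = "vec N (\<lambda>i. (- 1) ^ i) :: int vec"
  have "(\<Sum>i<2 * m. (- 1) ^ i) = (0 :: int)" by (induction m) auto
  then have "?z \<in> balanced_vectors N"
    by (auto simp: balanced_vectors_def sign_vectors_def m minus_one_power_iff)
  then show ?thesis by blast
qed

section \<open>The Hoffman bound for orthogonal splittings\<close>

text \<open>Positive semidefiniteness of \<open>(N - 1) A + C I - (N C / 2\<^sup>N) J\<close>, evaluated at \<open>f\<close> and scaled by
  \<open>2\<^sup>N\<close>. The number \<open>m S\<close> in the proof is the eigenvalue of this matrix at \<open>walsh S\<close>. It is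
  nonnegative by the eigenvalue bound if \<open>S \<noteq> {}\<close>, and the coefficient of \<open>J\<close> is chosen to make it
  \<open>0\<close> at \<open>S = {}\<close>.\<close>

lemma hadamard_hoffman_form:
  fixes f :: "int vec \<Rightarrow> complex"
  assumes N: "0 < N" "4 dvd N"
  shows "real N * real (card (balanced_vectors N)) * (cmod (\<Sum>x\<in>sign_vectors N. f x))\<^sup>2
    \<le> 2 ^ N * (real (card (balanced_vectors N)) * (\<Sum>x\<in>sign_vectors N. (cmod (f x))\<^sup>2)
      + (real N - 1) * Re (\<Sum>x\<in>sign_vectors N. \<Sum>y\<in>{y \<in> sign_vectors N. x \<bullet> y = 0}. f x * cnj (f y)))"
proof -
  let ?V = "sign_vectors N" and ?P = "Pow {..<N}"
  define C where "C = int (card (balanced_vectors N))"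
  define m where "m S = (int N - 1) * hadamard_eigenvalue N S + C - (if S = {} then int N * C else 0)" for S
  have finV: "finite ?V" using card_sign_vectors by blast
  have m: "0 \<le> m S" if "S \<in> ?P" for S
  proof (cases "S = {}")
    case True
    then show ?thesis by (simp add: m_def C_def hadamard_eigenvalue_empty algebra_simps)
  next
    case False
    then show ?thesis using hadamard_eigenvalue_ge[OF N(2), of S] that by (simp add: m_def C_def)
  qed
  have kernel: "(\<Sum>S\<in>?P. m S * (walsh S x * walsh S y))
    = (int N - 1) * (if x \<bullet> y = 0 then 2 ^ N else 0) + C * (if x = y then 2 ^ N else 0) - int N * C"
    if "x \<in> ?V" "y \<in> ?V" for x y
  proof -
    have "(\<Sum>S\<in>?P. m S * (walsh S x * walsh S y))
      = (\<Sum>S\<in>?P. (int N - 1) * (hadamard_eigenvalue N S * (walsh S x * walsh S y)))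
      + (\<Sum>S\<in>?P. C * (walsh S x * walsh S y))
      - (\<Sum>S\<in>?P. if S = {} then int N * C else 0)"
      unfolding sum.distrib[symmetric] sum_subtractf[symmetric]
      by (intro sum.cong) (auto simp: m_def walsh_def algebra_simps)
    also have "(\<Sum>S\<in>?P. if S = {} then int N * C else 0) = int N * C" by simp
    finally show ?thesis
      unfolding sum_distrib_left[symmetric] walsh_expansion_adjacency[OF that]
        walsh_orthogonality[OF that] .
  qed
  have norm: "of_real ((cmod z)\<^sup>2) = z * cnj z" for z by (rule complex_norm_square)
  have "complex_of_real (\<Sum>S\<in>?P. of_int (m S) * (cmod (\<Sum>x\<in>?V. of_int (walsh S x) * f x))\<^sup>2)
    = (\<Sum>S\<in>?P. of_int (m S) * (\<Sum>x\<in>?V. \<Sum>y\<in>?V. of_int (walsh S x) * f x * (of_int (walsh S y) * cnj (f y))))"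
    by (simp add: norm sum_product del: of_real_power)
  also have "\<dots> = (\<Sum>S\<in>?P. \<Sum>x\<in>?V. \<Sum>y\<in>?V. of_int (m S * (walsh S x * walsh S y)) * (f x * cnj (f y)))"
    by (simp add: sum_distrib_left mult_ac)
  also have "\<dots> = (\<Sum>x\<in>?V. \<Sum>S\<in>?P. \<Sum>y\<in>?V. of_int (m S * (walsh S x * walsh S y)) * (f x * cnj (f y)))"
    by (rule sum.swap)
  also have "\<dots> = (\<Sum>x\<in>?V. \<Sum>y\<in>?V. \<Sum>S\<in>?P. of_int (m S * (walsh S x * walsh S y)) * (f x * cnj (f y)))"
    by (intro sum.cong refl sum.swap)
  also have "\<dots> = (\<Sum>x\<in>?V. \<Sum>y\<in>?V. of_int (\<Sum>S\<in>?P. m S * (walsh S x * walsh S y)) * (f x * cnj (f y)))"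
    by (simp only: of_int_sum sum_distrib_right)
  also have "\<dots> = (\<Sum>x\<in>?V. \<Sum>y\<in>?V. (of_nat N - 1) * 2 ^ N * (if x \<bullet> y = 0 then f x * cnj (f y) else 0)
     + of_int C * 2 ^ N * (if x = y then f x * cnj (f x) else 0) - of_nat N * of_int C * (f x * cnj (f y)))"
    by (intro sum.cong refl) (auto simp: kernel algebra_simps)
  also have "\<dots> = (of_nat N - 1) * 2 ^ N * (\<Sum>x\<in>?V. \<Sum>y\<in>?V. if x \<bullet> y = 0 then f x * cnj (f y) else 0)
     + of_int C * 2 ^ N * (\<Sum>x\<in>?V. f x * cnj (f x))
     - of_nat N * of_int C * ((\<Sum>x\<in>?V. f x) * cnj (\<Sum>x\<in>?V. f x))"
    using finV by (simp add: sum.distrib sum_subtractf sum_distrib_left[symmetric] sum_product)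
  also have "(\<Sum>x\<in>?V. \<Sum>y\<in>?V. if x \<bullet> y = 0 then f x * cnj (f y) else 0)
    = (\<Sum>x\<in>?V. \<Sum>y\<in>{y \<in> ?V. x \<bullet> y = 0}. f x * cnj (f y))"
    using finV by (simp add: sum.inter_filter)
  finally have eq: "complex_of_real (\<Sum>S\<in>?P. of_int (m S) * (cmod (\<Sum>x\<in>?V. of_int (walsh S x) * f x))\<^sup>2)
    = of_real ((real N - 1) * 2 ^ N) * (\<Sum>x\<in>?V. \<Sum>y\<in>{y \<in> ?V. x \<bullet> y = 0}. f x * cnj (f y))
      + of_real (of_int C * 2 ^ N * (\<Sum>x\<in>?V. (cmod (f x))\<^sup>2) - real N * of_int C * (cmod (\<Sum>x\<in>?V. f x))\<^sup>2)"
    using of_real_power[of 2 N, where 'a = complex] by (simp add: norm del: of_real_power)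
  have Re_scale: "Re (of_real r * z) = r * Re z" for r z by simp
  have "0 \<le> (\<Sum>S\<in>?P. of_int (m S) * (cmod (\<Sum>x\<in>?V. of_int (walsh S x) * f x))\<^sup>2)"
    using m by (intro sum_nonneg mult_nonneg_nonneg) auto
  also have "\<dots> = (real N - 1) * 2 ^ N * Re (\<Sum>x\<in>?V. \<Sum>y\<in>{y \<in> ?V. x \<bullet> y = 0}. f x * cnj (f y))
      + (of_int C * 2 ^ N * (\<Sum>x\<in>?V. (cmod (f x))\<^sup>2) - real N * of_int C * (cmod (\<Sum>x\<in>?V. f x))\<^sup>2)"
    using arg_cong[OF eq, of Re] by (simp only: Re_complex_of_real plus_complex.sel Re_scale)
  finally show ?thesis by (simp add: C_def algebra_simps)
qed

text \<open>The scalar inequality is applied to each coordinate; after summation over the coordinates the edge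
  terms become the inner products that vanish by hypothesis.\<close>

lemma hadamard_hoffman_vectors:
  fixes v :: "int vec \<Rightarrow> complex vec"
  assumes N: "0 < N" "4 dvd N"
    and v: "\<And>x. x \<in> sign_vectors N \<Longrightarrow> v x \<in> carrier_vec n"
    and orth: "\<And>x y. x \<in> sign_vectors N \<Longrightarrow> y \<in> sign_vectors N \<Longrightarrow> x \<bullet> y = 0 \<Longrightarrow> v x \<bullet>c v y = 0"
  shows "real N * (\<Sum>k<n. (cmod (\<Sum>x\<in>sign_vectors N. v x $ k))\<^sup>2)
    \<le> 2 ^ N * (\<Sum>x\<in>sign_vectors N. Re (v x \<bullet>c v x))"
proof -
  let ?V = "sign_vectors N" and ?C = "real (card (balanced_vectors N))"
  let ?E = "\<lambda>k. \<Sum>x\<in>?V. \<Sum>y\<in>{y \<in> ?V. x \<bullet> y = 0}. v x $ k * cnj (v y $ k)"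
  have "(\<Sum>k<n. ?E k) = (\<Sum>x\<in>?V. \<Sum>k<n. \<Sum>y\<in>{y \<in> ?V. x \<bullet> y = 0}. v x $ k * cnj (v y $ k))"
    by (rule sum.swap)
  also have "\<dots> = (\<Sum>x\<in>?V. \<Sum>y\<in>{y \<in> ?V. x \<bullet> y = 0}. \<Sum>k<n. v x $ k * cnj (v y $ k))"
    by (intro sum.cong refl sum.swap)
  also have "\<dots> = 0"
  proof (rule sum.neutral, rule ballI, rule sum.neutral, rule ballI)
    fix x y assume "x \<in> ?V" "y \<in> {y \<in> ?V. x \<bullet> y = 0}"
    then show "(\<Sum>k<n. v x $ k * cnj (v y $ k)) = 0"
      using orth[of x y] cinner_sum[OF v v, of x y] by simp
  qed
  finally have E: "(\<Sum>k<n. Re (?E k)) = 0" by (metis Re_sum zero_complex.sel(1))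
  have D: "(\<Sum>k<n. \<Sum>x\<in>?V. (cmod (v x $ k))\<^sup>2) = (\<Sum>x\<in>?V. Re (v x \<bullet>c v x))"
    using v by (subst sum.swap) (simp add: cinner_norm[of _ n])
  have "(\<Sum>k<n. real N * ?C * (cmod (\<Sum>x\<in>?V. v x $ k))\<^sup>2)
    \<le> (\<Sum>k<n. 2 ^ N * (?C * (\<Sum>x\<in>?V. (cmod (v x $ k))\<^sup>2) + (real N - 1) * Re (?E k)))"
    by (intro sum_mono hadamard_hoffman_form N)
  also have "\<dots> = 2 ^ N * (?C * (\<Sum>k<n. \<Sum>x\<in>?V. (cmod (v x $ k))\<^sup>2) + (real N - 1) * (\<Sum>k<n. Re (?E k)))"
    by (simp only: sum_distrib_left sum.distrib distrib_left)
  also have "\<dots> = ?C * (2 ^ N * (\<Sum>x\<in>?V. Re (v x \<bullet>c v x)))"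
    unfolding E D by simp
  finally have "?C * (real N * (\<Sum>k<n. (cmod (\<Sum>x\<in>?V. v x $ k))\<^sup>2)) \<le> \<dots>"
    by (simp add: sum_distrib_left mult_ac)
  moreover have "0 < ?C"
    using balanced_vectors_nonempty[of N] finite_balanced_vectors[of N] N(2) by (auto simp: card_gt_0_iff)
  ultimately show ?thesis by simp
qed

text \<open>Hoffman's argument. Each colour class carries total weight \<open>s \<alpha>\<close> at most \<open>2\<^sup>N / N\<close>, while the
  weights of all classes add up to the number \<open>2\<^sup>N\<close> of vertices. For a classical colouring, \<open>v x \<alpha>\<close> is
  \<open>\<psi>\<close> or \<open>0\<close>, \<open>s \<alpha>\<close> is the size of the class, and this is the usual ratio bound.\<close>

lemma hadamard_orthogonal_splitting_bound:
  fixes v :: "int vec \<Rightarrow> nat \<Rightarrow> complex vec"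
  assumes N: "0 < N" "4 dvd N"
    and \<psi>: "\<psi> \<in> carrier_vec n" "\<psi> \<bullet>c \<psi> = 1"
    and v: "\<And>x \<alpha>. x \<in> sign_vectors N \<Longrightarrow> \<alpha> \<in> {1..c} \<Longrightarrow> v x \<alpha> \<in> carrier_vec n"
    and res: "\<And>x w. x \<in> sign_vectors N \<Longrightarrow> w \<in> carrier_vec n \<Longrightarrow> (\<Sum>\<alpha>=1..c. v x \<alpha> \<bullet>c w) = \<psi> \<bullet>c w"
    and proj: "\<And>x \<alpha>. x \<in> sign_vectors N \<Longrightarrow> \<alpha> \<in> {1..c} \<Longrightarrow> v x \<alpha> \<bullet>c \<psi> = v x \<alpha> \<bullet>c v x \<alpha>"
    and edge: "\<And>x y \<alpha>. x \<in> sign_vectors N \<Longrightarrow> y \<in> sign_vectors N \<Longrightarrow> x \<bullet> y = 0 \<Longrightarrow> \<alpha> \<in> {1..c} \<Longrightarrow>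
      v x \<alpha> \<bullet>c v y \<alpha> = 0"
  shows "N \<le> c"
proof -
  let ?V = "sign_vectors N"
  define s where "s \<alpha> = (\<Sum>x\<in>?V. Re (v x \<alpha> \<bullet>c v x \<alpha>))" for \<alpha>
  have bound: "real N * s \<alpha> \<le> 2 ^ N" if \<alpha>: "\<alpha> \<in> {1..c}" for \<alpha>
  proof -
    define u where "u = vec n (\<lambda>k. \<Sum>x\<in>?V. v x \<alpha> $ k)"
    have u: "u \<in> carrier_vec n" by (simp add: u_def)
    have su: "complex_of_real (s \<alpha>) \<cdot>\<^sub>v \<psi> \<in> carrier_vec n" using \<psi> by simp
    have "u \<bullet>c \<psi> = (\<Sum>k<n. \<Sum>x\<in>?V. v x \<alpha> $ k * cnj (\<psi> $ k))"
      using u \<psi> by (simp add: cinner_sum[of _ n] u_def sum_distrib_right)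
    also have "\<dots> = (\<Sum>x\<in>?V. v x \<alpha> \<bullet>c \<psi>)"
      using v[OF _ \<alpha>] \<psi> by (subst sum.swap) (simp add: cinner_sum[of _ n])
    also have "\<dots> = (\<Sum>x\<in>?V. v x \<alpha> \<bullet>c v x \<alpha>)"
      using proj \<alpha> by simp
    finally have u\<psi>: "Re (u \<bullet>c \<psi>) = s \<alpha>" by (simp add: s_def)
    then have \<psi>u: "Re (\<psi> \<bullet>c u) = s \<alpha>" using cinner_cnj[OF u \<psi>(1)] by (metis cnj.sel(1))
    have uu: "Re (u \<bullet>c u) = (\<Sum>k<n. (cmod (\<Sum>x\<in>?V. v x \<alpha> $ k))\<^sup>2)"
      using u by (simp add: cinner_norm[of _ n] u_def)
    \<comment> \<open>The Cauchy-Schwarz inequality for \<open>u\<close> and the unit vector \<open>\<psi>\<close>: subtract from \<open>u\<close> its component along \<open>\<psi>\<close>.\<close>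
    have "0 \<le> Re ((u - complex_of_real (s \<alpha>) \<cdot>\<^sub>v \<psi>) \<bullet>c (u - complex_of_real (s \<alpha>) \<cdot>\<^sub>v \<psi>))"
      using cinner_norm[of "u - complex_of_real (s \<alpha>) \<cdot>\<^sub>v \<psi>" n] u su
      by (simp add: sum_nonneg del: index_minus_vec)
    also have "\<dots> = Re (u \<bullet>c u) - (s \<alpha>)\<^sup>2"
      using u su \<psi> u\<psi> \<psi>u
      by (simp add: cinner_minus_left[of _ n] cinner_minus_right[of _ n] conjugate_smult_vec
          power2_eq_square)
    finally have "(s \<alpha>)\<^sup>2 \<le> Re (u \<bullet>c u)" by simp
    then have "real N * (s \<alpha>)\<^sup>2 \<le> real N * Re (u \<bullet>c u)" by (intro mult_left_mono) auto
    also have "\<dots> \<le> 2 ^ N * s \<alpha>"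
      unfolding uu s_def using v[OF _ \<alpha>] edge[OF _ _ _ \<alpha>] by (intro hadamard_hoffman_vectors N) auto
    finally have "s \<alpha> * (real N * s \<alpha>) \<le> s \<alpha> * 2 ^ N" by (simp add: power2_eq_square mult_ac)
    then show ?thesis
    proof (cases "0 < s \<alpha>")
      case False
      then have "real N * s \<alpha> \<le> 0" by (intro mult_nonneg_nonpos) auto
      then show ?thesis by (meson order_trans zero_le_numeral zero_le_power)
    qed simp
  qed
  have "(\<Sum>\<alpha>=1..c. s \<alpha>) = (\<Sum>x\<in>?V. \<Sum>\<alpha>=1..c. Re (v x \<alpha> \<bullet>c v x \<alpha>))"
    unfolding s_def by (rule sum.swap)
  also have "\<dots> = (\<Sum>x\<in>?V. Re (\<Sum>\<alpha>=1..c. v x \<alpha> \<bullet>c \<psi>))"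
    by (simp add: proj)
  also have "\<dots> = 2 ^ N"
    using card_sign_vectors[of N] by (simp add: res[OF _ \<psi>(1)] \<psi>(2) del: One_nat_def)
  finally have "real N * 2 ^ N = (\<Sum>\<alpha>=1..c. real N * s \<alpha>)" by (simp add: sum_distrib_left[symmetric])
  also have "\<dots> \<le> (\<Sum>\<alpha>=1..c. 2 ^ N)" by (intro sum_mono bound)
  finally show ?thesis by simp
qed

lemma winning_quantum_strategy_colours_ge:
  assumes N: "0 < N" "4 dvd N"
    and W: "winning_quantum_strategy (hadamard_graph N) c a b \<psi> E F"
  shows "N \<le> c"
proof -
  let ?V = "sign_vectors N"
  define P where "P x \<alpha> = kronecker (E x \<alpha>) (1\<^sub>m b)" for x \<alpha>
  define Q where "Q x \<alpha> = kronecker (1\<^sub>m a) (F x \<alpha>)" for x \<alpha>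
  have \<psi>: "\<psi> \<in> carrier_vec (a * b)" "\<psi> \<bullet>c \<psi> = 1"
    using W by (auto simp: winning_quantum_strategy_def)
  have EF: "povm a c (E x)" "povm b c (F x)" if "x \<in> ?V" for x
    using W that by (auto simp: winning_quantum_strategy_def hadamard_graph_def)
  have PQ: "povm (a * b) c (P x)" "povm (a * b) c (Q x)" if "x \<in> ?V" for x
    unfolding P_def Q_def using EF[OF that] by (auto intro: povm_kronecker_left povm_kronecker_right)
  have out: "outcome_prob \<psi> (E x \<alpha>) (F y \<beta>) = (Q y \<beta> *\<^sub>v \<psi>) \<bullet>c (P x \<alpha> *\<^sub>v \<psi>)"
    if "x \<in> ?V" "y \<in> ?V" "\<alpha> \<in> {1..c}" "\<beta> \<in> {1..c}" for x y \<alpha> \<beta>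
    unfolding P_def Q_def
    using povmD(1,2)[OF EF(1)[OF that(1)] that(3)] povmD(1)[OF EF(2)[OF that(2)] that(4)] \<psi>(1)
    by (rule outcome_prob_cinner)
  have orth: "(Q x \<beta> *\<^sub>v \<psi>) \<bullet>c (P x \<alpha> *\<^sub>v \<psi>) = 0"
    if "x \<in> ?V" "\<alpha> \<in> {1..c}" "\<beta> \<in> {1..c}" "\<alpha> \<noteq> \<beta>" for x \<alpha> \<beta>
    using W that out[of x x \<alpha> \<beta>] by (auto simp: winning_quantum_strategy_def hadamard_graph_def)
  have agree: "P x \<alpha> *\<^sub>v \<psi> = Q x \<alpha> *\<^sub>v \<psi>" if "x \<in> ?V" "\<alpha> \<in> {1..c}" for x \<alpha>
    using PQ[OF that(1)] \<psi>(1) orth[OF that(1)] that(2) by (rule consistent_povms_agree)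
  have car: "Q x \<alpha> *\<^sub>v \<psi> \<in> carrier_vec (a * b)" if "x \<in> ?V" "\<alpha> \<in> {1..c}" for x \<alpha>
    using povmD(1)[OF PQ(2)[OF that(1)] that(2)] \<psi>(1) by simp
  show ?thesis
  proof (rule hadamard_orthogonal_splitting_bound[OF N \<psi>, of c "\<lambda>x \<alpha>. Q x \<alpha> *\<^sub>v \<psi>"])
    fix x and w :: "complex vec" assume "x \<in> ?V" "w \<in> carrier_vec (a * b)"
    then show "(\<Sum>\<alpha>=1..c. (Q x \<alpha> *\<^sub>v \<psi>) \<bullet>c w) = \<psi> \<bullet>c w"
      using povm_resolution_cinner[OF PQ(2) \<psi>(1)] by blast
  next
    fix x \<alpha> assume x: "x \<in> ?V" "\<alpha> \<in> {1..c}"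
    have "\<psi> \<bullet>c (Q x \<alpha> *\<^sub>v \<psi>) = (\<Sum>\<beta>=1..c. (Q x \<beta> *\<^sub>v \<psi>) \<bullet>c (Q x \<alpha> *\<^sub>v \<psi>))"
      using povm_resolution_cinner[OF PQ(2)[OF x(1)] \<psi>(1) car[OF x]] by simp
    also have "\<dots> = (\<Sum>\<beta>=1..c. if \<beta> = \<alpha> then (Q x \<alpha> *\<^sub>v \<psi>) \<bullet>c (Q x \<alpha> *\<^sub>v \<psi>) else 0)"
      using orth[OF x] x by (intro sum.cong refl) (auto simp: agree[symmetric] simp del: One_nat_def)
    also have "\<dots> = (Q x \<alpha> *\<^sub>v \<psi>) \<bullet>c (Q x \<alpha> *\<^sub>v \<psi>)" using x by simp
    finally show "(Q x \<alpha> *\<^sub>v \<psi>) \<bullet>c \<psi> = (Q x \<alpha> *\<^sub>v \<psi>) \<bullet>c (Q x \<alpha> *\<^sub>v \<psi>)"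
      using cinner_cnj[OF \<psi>(1) car[OF x]] cinner_cnj[OF car[OF x] car[OF x]] by simp
  next
    fix x y \<alpha> assume x: "x \<in> ?V" "y \<in> ?V" "x \<bullet> y = 0" "\<alpha> \<in> {1..c}"
    have "x \<bullet> y = y \<bullet> x" using x by (intro comm_scalar_prod) (auto simp: sign_vectors_def)
    then have "outcome_prob \<psi> (E y \<alpha>) (F x \<alpha>) = 0"
      using W x by (auto simp: winning_quantum_strategy_def hadamard_graph_def)
    then show "(Q x \<alpha> *\<^sub>v \<psi>) \<bullet>c (Q y \<alpha> *\<^sub>v \<psi>) = 0"
      using out[of y x \<alpha> \<alpha>] x agree[of y \<alpha>] by simp
  qed (rule car)
qed

section \<open>The Fourier strategy\<close>

definition outer_product :: "nat \<Rightarrow> (nat \<Rightarrow> complex) \<Rightarrow> complex mat" where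
  "outer_product n u = mat n n (\<lambda>(i, j). u i * cnj (u j))"

definition max_entangled :: "nat \<Rightarrow> complex vec" where
  "max_entangled n = vec (n * n) (\<lambda>k. if k div n = k mod n then complex_of_real (1 / sqrt (real n)) else 0)"

text \<open>For fixed \<open>x\<close> these are the vectors of an orthonormal basis, indexed by \<open>\<alpha>\<close>: the discrete
  Fourier basis with its coordinates multiplied by the signs of \<open>x\<close>.\<close>

definition twisted_fourier :: "nat \<Rightarrow> int vec \<Rightarrow> nat \<Rightarrow> nat \<Rightarrow> complex" where
  "twisted_fourier N x \<alpha> i =
    of_int (x $ i) * cis (2 * pi * real \<alpha> * real i / real N) / complex_of_real (sqrt (real N))"

lemma outer_product_carrier [simp]: "outer_product n u \<in> carrier_mat n n"
  by (simp add: outer_product_def)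

lemma pos_semidef_outer_product: "pos_semidef n (outer_product n u)"
proof -
  have "0 \<le> (outer_product n u *\<^sub>v v) \<bullet>c v" if v: "v \<in> carrier_vec n" for v
  proof -
    let ?z = "\<Sum>j<n. cnj (u j) * v $ j"
    have "(outer_product n u *\<^sub>v v) \<bullet>c v = (\<Sum>i<n. \<Sum>j<n. u i * cnj (u j) * v $ j * cnj (v $ i))"
      unfolding cinner_sum[OF mult_mat_vec_carrier[OF outer_product_carrier v] v]
      using v by (simp add: mult_mat_vec_sum[OF outer_product_carrier v] sum_distrib_right
          del: index_mult_mat_vec) (simp add: outer_product_def)
    also have "\<dots> = cnj ?z * ?z"
      by (simp add: sum_product mult_ac)
    also have "\<dots> = of_real ((cmod ?z)\<^sup>2)"
      by (simp only: complex_norm_square mult.commute)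
    finally show ?thesis by (simp add: less_eq_complex_def del: of_real_power)
  qed
  moreover have "mat_adjoint (outer_product n u) = outer_product n u"
  proof (rule eq_matI)
    fix i j assume "i < dim_row (outer_product n u)" "j < dim_col (outer_product n u)"
    then have ij: "i < n" "j < n" by (simp_all add: outer_product_def)
    show "mat_adjoint (outer_product n u) $$ (i, j) = outer_product n u $$ (i, j)"
      unfolding mat_adjoint_index[OF outer_product_carrier ij]
      using ij by (simp add: outer_product_def)
  qed (use mat_adjoint_carrier[OF outer_product_carrier[of n u]] in \<open>auto simp: outer_product_def\<close>)
  ultimately show ?thesis by (simp add: pos_semidef_def)
qed

lemma povm_outer_product:
  assumes "\<And>i j. i < n \<Longrightarrow> j < n \<Longrightarrow> (\<Sum>\<alpha>=1..c. u \<alpha> i * cnj (u \<alpha> j)) = (if i = j then 1 else 0)"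
  shows "povm n c (\<lambda>\<alpha>. outer_product n (u \<alpha>))"
  unfolding povm_def
proof (intro conjI ballI pos_semidef_outer_product)
  show "mat n n (\<lambda>ij. \<Sum>\<alpha>=1..c. outer_product n (u \<alpha>) $$ ij) = 1\<^sub>m n"
    using assms by (intro eq_matI) (auto simp: outer_product_def)
qed

lemma max_entangled_index:
  assumes "i < n" "j < n"
  shows "max_entangled n $ (i * n + j) = (if i = j then complex_of_real (1 / sqrt (real n)) else 0)"
  using assms by (simp add: max_entangled_def pair_index_less)

lemma max_entangled_carrier: "max_entangled n \<in> carrier_vec (n * n)"
  by (simp add: max_entangled_def)

lemma inverse_sqrt_square:
  "complex_of_real (1 / sqrt (real n)) * complex_of_real (1 / sqrt (real n)) = 1 / of_nat n"
  unfolding of_real_mult[symmetric] by (simp add: real_sqrt_mult[symmetric])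

lemma max_entangled_unit:
  assumes "0 < n"
  shows "max_entangled n \<bullet>c max_entangled n = 1"
proof -
  have "max_entangled n \<bullet>c max_entangled n
    = (\<Sum>i<n. \<Sum>j<n. if i = j then 1 / of_nat n else 0)"
    unfolding cinner_sum[OF max_entangled_carrier max_entangled_carrier] sum_lessThan_mult
    by (intro sum.cong refl)
      (simp add: max_entangled_index inverse_sqrt_square del: of_real_divide)
  also have "\<dots> = of_nat n * (1 / of_nat n)" by simp
  finally show ?thesis using assms by simp
qed

lemma outcome_prob_max_entangled:
  assumes A: "A \<in> carrier_mat n n" and B: "B \<in> carrier_mat n n"
  shows "outcome_prob (max_entangled n) A B = (\<Sum>i<n. \<Sum>k<n. A $$ (i, k) * B $$ (i, k)) / of_nat n"
proof -
  let ?r = "complex_of_real (1 / sqrt (real n))"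
  have r: "?r * ?r = 1 / of_nat n" by (rule inverse_sqrt_square)
  have "outcome_prob (max_entangled n) A B = (\<Sum>i<n. \<Sum>j<n. \<Sum>k<n. \<Sum>l<n.
    A $$ (i, k) * B $$ (j, l) * max_entangled n $ (k * n + l) * cnj (max_entangled n $ (i * n + j)))"
    unfolding outcome_prob_def
    by (rule kronecker_cinner[OF A B max_entangled_carrier max_entangled_carrier])
  also have "\<dots> = (\<Sum>i<n. \<Sum>j<n. \<Sum>k<n. \<Sum>l<n.
    if k = l then if i = j then A $$ (i, k) * B $$ (j, k) * (?r * ?r) else 0 else 0)"
    by (intro sum.cong refl) (simp add: max_entangled_index)
  also have "\<dots> = (\<Sum>i<n. \<Sum>j<n. if i = j then \<Sum>k<n. A $$ (i, k) * B $$ (j, k) * (?r * ?r) else 0)"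
    by (intro sum.cong refl) simp
  also have "\<dots> = (\<Sum>i<n. \<Sum>k<n. A $$ (i, k) * B $$ (i, k) * (?r * ?r))" by simp
  finally show ?thesis unfolding r by (simp add: sum_divide_distrib)
qed

text \<open>On the maximally entangled state, the outcomes \<open>u u\<^sup>*\<close> and the complex conjugate of \<open>w w\<^sup>*\<close> occur
  together with probability \<open>\<bar>\<langle>u, w\<rangle>\<bar>\<^sup>2 / n\<close>.\<close>

lemma outcome_prob_outer_product:
  assumes "(\<Sum>i<n. u i * cnj (w i)) = 0"
  shows "outcome_prob (max_entangled n) (outer_product n u) (outer_product n (\<lambda>i. cnj (w i))) = 0"
proof -
  have "(\<Sum>i<n. \<Sum>k<n. outer_product n u $$ (i, k) * outer_product n (\<lambda>i. cnj (w i)) $$ (i, k))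
    = (\<Sum>i<n. u i * cnj (w i)) * (\<Sum>k<n. cnj (u k) * w k)"
    by (simp add: outer_product_def sum_product mult_ac)
  then show ?thesis using assms by (simp add: outcome_prob_max_entangled)
qed

text \<open>Both index ranges occur: coordinates run through \<open>{..<N}\<close> and colours through \<open>{1..N}\<close>. Either way
  the sum runs over all powers of an \<open>N\<close>-th root of unity \<open>z \<noteq> 1\<close>.\<close>

lemma sum_cis_orthogonality:
  assumes "a \<noteq> b" "\<bar>int a - int b\<bar> < int N"
  shows "(\<Sum>k<N. cis (2 * pi * real a * real k / real N) * cnj (cis (2 * pi * real b * real k / real N))) = 0"
    and "(\<Sum>k=1..N. cis (2 * pi * real a * real k / real N) * cnj (cis (2 * pi * real b * real k / real N))) = 0"
proof -
  have N: "0 < N" using assms by auto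
  define z where "z = cis (2 * pi * (real a - real b) / real N)"
  have f: "cis (2 * pi * real a * real k / real N) * cnj (cis (2 * pi * real b * real k / real N)) = z ^ k" for k
    by (simp add: z_def DeMoivre cis_cnj cis_mult diff_divide_distrib algebra_simps)
  have "z ^ N = cis (2 * pi * real_of_int (int a - int b))"
    using N by (simp add: z_def DeMoivre)
  then have zN: "z ^ N = 1" by (simp only: cis_multiple_2pi Ints_of_int)
  have "z \<noteq> 1"
  proof
    assume "z = 1"
    then have "cos (2 * pi * (real a - real b) / real N) = 1" by (metis z_def cis.sel(1) one_complex.sel(1))
    then obtain m :: int where "2 * pi * (real a - real b) / real N = real_of_int m * 2 * pi"
      unfolding cos_one_2pi_int by blast
    then have "(2 * pi) * (real a - real b) = (2 * pi) * (real_of_int m * real N)"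
      using N by (simp add: field_simps)
    then have "real a - real b = real_of_int m * real N"
      by (simp only: mult_cancel_left) simp
    then have m: "int a - int b = m * int N" by (metis (mono_tags) of_int_diff of_int_eq_iff of_int_mult of_int_of_nat_eq)
    then have "m \<noteq> 0" using assms(1) by auto
    then have "1 * int N \<le> \<bar>m\<bar> * int N" by (intro mult_right_mono) auto
    then show False using assms(2) m by (simp add: abs_mult)
  qed
  then have s: "(\<Sum>k<N. z ^ k) = 0" using zN by (simp add: geometric_sum)
  then show "(\<Sum>k<N. cis (2 * pi * real a * real k / real N) * cnj (cis (2 * pi * real b * real k / real N))) = 0"
    unfolding f .
  have "(\<Sum>k=1..N. z ^ k) = (\<Sum>k<N. z ^ Suc k)"
    by (rule sum.reindex_bij_witness[of _ Suc "\<lambda>k. k - 1"]) auto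
  also have "\<dots> = 0" using s by (simp add: sum_distrib_left[symmetric])
  finally show "(\<Sum>k=1..N. cis (2 * pi * real a * real k / real N) * cnj (cis (2 * pi * real b * real k / real N))) = 0"
    unfolding f .
qed

lemma twisted_fourier_mult_cnj:
  "twisted_fourier N x \<alpha> i * cnj (twisted_fourier N y \<beta> j) = of_int (x $ i * y $ j) *
    (cis (2 * pi * real \<alpha> * real i / real N) * cnj (cis (2 * pi * real \<beta> * real j / real N))) / of_nat N"
proof -
  have "complex_of_real (sqrt (real N)) * complex_of_real (sqrt (real N)) = of_nat N"
    unfolding of_real_mult[symmetric] by (simp add: real_sqrt_mult[symmetric])
  then show ?thesis by (simp add: twisted_fourier_def)
qed

lemma twisted_fourier_resolution:
  assumes N: "0 < N" and x: "x \<in> sign_vectors N" and ij: "i < N" "j < N"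
  shows "(\<Sum>\<alpha>=1..N. twisted_fourier N x \<alpha> i * cnj (twisted_fourier N x \<alpha> j)) = (if i = j then 1 else 0)"
proof (cases "i = j")
  case True
  then show ?thesis using N sign_vectors_square[OF x ij(1)]
    by (simp add: twisted_fourier_mult_cnj cis_cnj cis_mult del: of_int_mult)
next
  case False
  have "(\<Sum>\<alpha>=1..N. twisted_fourier N x \<alpha> i * cnj (twisted_fourier N x \<alpha> j)) = of_int (x $ i * x $ j) *
    (\<Sum>\<alpha>=1..N. cis (2 * pi * real i * real \<alpha> / real N) * cnj (cis (2 * pi * real j * real \<alpha> / real N))) / of_nat N"
    unfolding twisted_fourier_mult_cnj sum_distrib_left sum_divide_distrib by (simp add: mult_ac)
  also have "\<dots> = 0" using sum_cis_orthogonality(2)[of i j N] False ij by simp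
  finally show ?thesis using False by simp
qed

lemma twisted_fourier_orthogonal:
  assumes x: "x \<in> sign_vectors N" and "\<alpha> \<in> {1..N}" "\<beta> \<in> {1..N}" "\<alpha> \<noteq> \<beta>"
  shows "(\<Sum>i<N. twisted_fourier N x \<alpha> i * cnj (twisted_fourier N x \<beta> i)) = 0"
proof -
  have "(\<Sum>i<N. twisted_fourier N x \<alpha> i * cnj (twisted_fourier N x \<beta> i)) =
    (\<Sum>i<N. cis (2 * pi * real \<alpha> * real i / real N) * cnj (cis (2 * pi * real \<beta> * real i / real N))) / of_nat N"
    unfolding twisted_fourier_mult_cnj sum_divide_distrib
    by (intro sum.cong refl) (simp add: sign_vectors_square[OF x] del: of_int_mult)
  also have "\<dots> = 0" using sum_cis_orthogonality(1)[of \<alpha> \<beta> N] assms by auto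
  finally show ?thesis .
qed

text \<open>For equal colours the phases cancel, and only the signs remain.\<close>

lemma twisted_fourier_orthogonal_adjacent:
  assumes y: "y \<in> sign_vectors N" and xy: "x \<bullet> y = 0"
  shows "(\<Sum>i<N. twisted_fourier N x \<alpha> i * cnj (twisted_fourier N y \<alpha> i)) = 0"
proof -
  have "(\<Sum>i<N. twisted_fourier N x \<alpha> i * cnj (twisted_fourier N y \<alpha> i)) = of_int (\<Sum>i<N. x $ i * y $ i) / of_nat N"
    unfolding twisted_fourier_mult_cnj by (simp add: cis_cnj cis_mult sum_divide_distrib)
  also have "(\<Sum>i<N. x $ i * y $ i) = x \<bullet> y"
    using y by (auto simp: scalar_prod_def sign_vectors_def atLeast0LessThan)
  finally show ?thesis using xy by simp
qed

lemma hadamard_graph_quantum_colouring: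
  assumes N: "0 < N"
  shows "winning_quantum_strategy (hadamard_graph N) N N N (max_entangled N)
    (\<lambda>x \<alpha>. outer_product N (twisted_fourier N x \<alpha>))
    (\<lambda>x \<alpha>. outer_product N (\<lambda>i. cnj (twisted_fourier N x \<alpha> i)))"
proof -
  have "povm N N (\<lambda>\<alpha>. outer_product N (twisted_fourier N x \<alpha>))" if "x \<in> sign_vectors N" for x
    using twisted_fourier_resolution[OF N that] by (rule povm_outer_product)
  moreover have "povm N N (\<lambda>\<alpha>. outer_product N (\<lambda>i. cnj (twisted_fourier N x \<alpha> i)))"
    if "x \<in> sign_vectors N" for x
  proof (rule povm_outer_product)
    fix i j assume "i < N" "j < N"
    then show "(\<Sum>\<alpha>=1..N. cnj (twisted_fourier N x \<alpha> i) * cnj (cnj (twisted_fourier N x \<alpha> j)))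
      = (if i = j then 1 else 0)"
      using twisted_fourier_resolution[OF N that, of j i] by (cases "i = j") (simp_all add: mult.commute del: One_nat_def)
  qed
  moreover have "outcome_prob (max_entangled N) (outer_product N (twisted_fourier N x \<alpha>))
      (outer_product N (\<lambda>i. cnj (twisted_fourier N x \<beta> i))) = 0"
    if "x \<in> sign_vectors N" "\<alpha> \<in> {1..N}" "\<beta> \<in> {1..N}" "\<alpha> \<noteq> \<beta>" for x \<alpha> \<beta>
    by (intro outcome_prob_outer_product twisted_fourier_orthogonal that)
  moreover have "outcome_prob (max_entangled N) (outer_product N (twisted_fourier N x \<alpha>))
      (outer_product N (\<lambda>i. cnj (twisted_fourier N y \<alpha> i))) = 0"
    if "y \<in> sign_vectors N" "x \<bullet> y = 0" for x y \<alpha>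
    by (intro outcome_prob_outer_product twisted_fourier_orthogonal_adjacent that)
  ultimately show ?thesis
    using N max_entangled_carrier[of N] max_entangled_unit[OF N]
    by (simp add: winning_quantum_strategy_def hadamard_graph_def del: One_nat_def)
qed

section \<open>The quantum chromatic number\<close>

theorem theorem0p1:
  fixes N :: nat
  assumes "0 < N" and "4 dvd N"
  shows "quantum_chromatic_number (hadamard_graph N) = N"
  unfolding quantum_chromatic_number_def
proof (rule Least_equality)
  show "0 < N \<and> (\<exists>a b \<psi> E F. winning_quantum_strategy (hadamard_graph N) N a b \<psi> E F)"
    using assms(1) hadamard_graph_quantum_colouring by blast
  fix c assume "0 < c \<and> (\<exists>a b \<psi> E F. winning_quantum_strategy (hadamard_graph N) c a b \<psi> E F)"
  then show "N \<le> c" using winning_quantum_strategy_colours_ge[OF assms] by blast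
qed

end
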